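(* Let $a,b\geq 1$, $m,p,q>1$ and $n\geq 4$ be integers. The graph $aH_{m,p}\boxtimes bH_{n,q}$ is distance magic if and only if $m\equiv n\equiv 0\pmod 2$ or $mnabpq\equiv 1 \pmod 2$.
   Context: A graph $G$ on $v$ vertices is distance magic if there is a bijection $f:V(G)\to\{1,\ldots,v\}$ and a constant $k$ such that for every vertex $x$, $\sum_{y\in N(x)}f(y)=k$, where $N(x)$ is the set of neighbours of $x$. $H_{n,p}$ denotes the complete multipartite graph with $p$ partite sets each of size $n$; for a positive integer $a$, $aG$ denotes the disjoint union of $a$ copies of $G$. The strong product $G\boxtimes H$ has vertex set $V(G)\times V(H)$, with $(g,h)$ adjacent to $(g',h')$ iff either $g=g'$ and $hh'\in E(H)$, or $h=h'$ and $gg'\in E(G)$, or $gg'\in E(G)$ and $hh'\in E(H)$. *)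

theory Defs
  imports Main
begin

text \<open>A (simple) graph is a vertex set together with an adjacency relation;
  only adjacencies between vertices of the vertex set are relevant.\<close>
type_synonym 'a graph = "'a set \<times> ('a \<Rightarrow> 'a \<Rightarrow> bool)"

definition verts :: "'a graph \<Rightarrow> 'a set" where "verts G = fst G"
definition adj :: "'a graph \<Rightarrow> 'a \<Rightarrow> 'a \<Rightarrow> bool" where "adj G = snd G"

definition nbhd :: "'a graph \<Rightarrow> 'a \<Rightarrow> 'a set" where
  "nbhd G x = {y \<in> verts G. adj G x y}"

definition distance_magic :: "'a graph \<Rightarrow> bool" where
  "distance_magic G \<longleftrightarrow> finite (verts G) \<and>
     (\<exists>(f :: 'a \<Rightarrow> nat) k. bij_betw f (verts G) {1..card (verts G)} \<and>
        (\<forall>x \<in> verts G. (\<Sum>y \<in> nbhd G x. f y) = k))"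

definition complete_multipartite :: "nat \<Rightarrow> nat \<Rightarrow> (nat \<times> nat) graph" where
  "complete_multipartite n p = ({0..<p} \<times> {0..<n}, (\<lambda>(i, _) (i', _). i \<noteq> i'))"

definition copies :: "nat \<Rightarrow> 'a graph \<Rightarrow> (nat \<times> 'a) graph" where
  "copies a G = ({0..<a} \<times> verts G, (\<lambda>(i, x) (i', x'). i = i' \<and> adj G x x'))"

definition strong_product :: "'a graph \<Rightarrow> 'b graph \<Rightarrow> ('a \<times> 'b) graph" where
  "strong_product G H = (verts G \<times> verts H,
     (\<lambda>(g, h) (g', h'). (g = g' \<and> adj H h h') \<or> (h = h' \<and> adj G g g') \<or>
                         (adj G g g' \<and> adj H h h')))"

end

theory Submission
  imports Defs
begin

text \<open>With $A$, $A'$ the adjacency matrices of the factors, a labelling $f$ is magic iff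
  $((A+I)\otimes(A'+I)-I)f$ is constant. The eigenvalues of $A+I$ are $m(p-1)+1$, $1$ and $1-m$, those of
  $A'+I$ are $n(q-1)+1$, $1$ and $1-n$, and as $n\ge 4$ a product of two of them is $1$ only if both are $1$.
  Hence $f$ is magic iff it splits into $c=abpq$ rectangles of size $m\times n$ with equal row sums
  and equal column sums. The value of these sums forces the parity condition.

  Conversely such rectangles are built from pairs of rows $r$, $-r$ of deviations from the
  mean, where $r$ has sum zero. For even $m$, $n$ these suffice. For odd $m$, $n$ a core of three rows
  $\{wW+y : w\in\{-1,0,1\}, |y|\le (n-1)/2\}$ is added, with $W$ chosen such that the absolute values
  outside the core can be distributed to the rows $r$; the $c$ copies
  are then obtained by adding Kotzig arrays as a further digit.\<close>

section \<open>Rows with zero sum\<close>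

text \<open>Each \<open>d\<close> supplies the absolute values \<open>d\<close> and
  \<open>d + e\<close> with opposite signs. Switching the positive member from one pair to the next
  makes successive pairs cancel, so a surplus \<open>e\<close> remains only for an odd number of
  pairs.\<close>

lemma paired_row:
  fixes ds :: "nat list" and e :: nat
  shows "\<exists>r::int list. length r = 2 * length ds \<and>
    sum_list r = (if even (length ds) then 0 else int e) \<and>
    int ` set ds \<union> (\<lambda>d. int (d + e)) ` set ds \<subseteq> abs ` set r"
proof (induction ds)
  case Nil
  show ?case by simp
next
  case (Cons d ds)
  then obtain r :: "int list" where r: "length r = 2 * length ds"
    "sum_list r = (if even (length ds) then 0 else int e)"
    "int ` set ds \<union> (\<lambda>d. int (d + e)) ` set ds \<subseteq> abs ` set r"
    by blast
  define r' where "r' = (if even (length ds) then [int (d + e), - int d] else [int d, - int (d + e)]) @ r"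
  have "{int d, int (d + e)} \<subseteq> abs ` set r'"
    unfolding r'_def by simp
  moreover have "abs ` set r \<subseteq> abs ` set r'"
    unfolding r'_def by auto
  ultimately have "int ` set (d # ds) \<union> (\<lambda>d. int (d + e)) ` set (d # ds) \<subseteq> abs ` set r'"
    using r(3) by simp (blast dest: subsetD)
  moreover have "length r' = 2 * length (d # ds)"
    "sum_list r' = (if even (length (d # ds)) then 0 else int e)"
    using r(1,2) by (auto simp: r'_def)
  ultimately show ?case by blast
qed

text \<open>The list \<open>ds\<close> is cut into blocks of length \<open>k\<close>, and each row
  of \<open>T\<close> is prolonged by the \<open>k\<close> signed pairs of one block. The row sum
  \<open>s\<close> has to absorb the surplus of an odd number of pairs.\<close>

lemma extend_rows:
  fixes T :: "int list list" and ds :: "nat list"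
  assumes "\<And>r. r \<in> set T \<Longrightarrow> length r = l \<and> sum_list r = s"
    and "length ds = length T * k"
    and s: "s + (if even k then 0 else int e) = 0"
  shows "\<exists>S. length S = length T \<and> (\<forall>r\<in>set S. length r = l + 2 * k \<and> sum_list r = 0) \<and>
    abs ` set (concat T) \<union> int ` set ds \<union> (\<lambda>d. int (d + e)) ` set ds \<subseteq> abs ` set (concat S)"
  using assms(1,2)
proof (induction T arbitrary: ds)
  case Nil
  then show ?case by simp
next
  case (Cons t T)
  have len: "length (take k ds) = k" "length (drop k ds) = length T * k"
    using Cons.prems(2) by auto
  obtain S where S: "length S = length T" "\<forall>r\<in>set S. length r = l + 2 * k \<and> sum_list r = 0"
    "abs ` set (concat T) \<union> int ` set (drop k ds) \<union> (\<lambda>d. int (d + e)) ` set (drop k ds) \<subseteq> abs ` set (concat S)"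
    using Cons.IH[of "drop k ds"] Cons.prems(1) len(2) by auto
  obtain r :: "int list" where r: "length r = 2 * k" "sum_list r = (if even k then 0 else int e)"
    "int ` set (take k ds) \<union> (\<lambda>d. int (d + e)) ` set (take k ds) \<subseteq> abs ` set r"
    using paired_row[of "take k ds" e] len(1) by auto
  have ds: "set ds = set (take k ds) \<union> set (drop k ds)"
    by (metis append_take_drop_id set_append)
  have "length t = l" "sum_list t = s" using Cons.prems(1) by auto
  then have "\<forall>q\<in>set ((t @ r) # S). length q = l + 2 * k \<and> sum_list q = 0"
    using S(2) r(1,2) s by auto
  moreover have "abs ` set (concat (t # T)) \<union> int ` set ds \<union> (\<lambda>d. int (d + e)) ` set ds
      \<subseteq> abs ` set (concat ((t @ r) # S))"
  proof -
    have "abs ` set r \<subseteq> abs ` set (concat ((t @ r) # S))" "abs ` set (concat S) \<subseteq> abs ` set (concat ((t @ r) # S))"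
      "abs ` set t \<subseteq> abs ` set (concat ((t @ r) # S))"
      by (auto intro!: image_mono)
    then show ?thesis
      using S(3) r(3) unfolding ds image_Un concat.simps set_append Un_subset_iff
      by (elim conjE) (intro conjI; (assumption | erule (1) order_trans))
  qed
  ultimately show ?case
    using S(1) by (intro exI[of _ "(t @ r) # S"]) auto
qed

section \<open>Covering intervals by pairs and by triples\<close>

definition run :: "nat \<Rightarrow> nat \<Rightarrow> nat list" where
  "run p q = map (\<lambda>i. p + 1 + 2 * i) [0..<(q - p) div 2]"

lemma length_run [simp]: "length (run p q) = (q - p) div 2"
  by (simp add: run_def)

lemma run_cover:
  assumes "even (q - p)"
  shows "int ` {p<..q} \<subseteq> int ` set (run p q) \<union> (\<lambda>d. int (d + 1)) ` set (run p q)"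
proof
  fix z assume "z \<in> int ` {p<..q}"
  then obtain x where x: "z = int x" "p < x" "x \<le> q" by auto
  define i where "i = (x - p - 1) div 2"
  have i: "i < (q - p) div 2" using x assms unfolding i_def by presburger
  have "x = p + 1 + 2 * i \<or> x = p + 1 + 2 * i + 1" using x unfolding i_def by presburger
  moreover have "p + 1 + 2 * i \<in> set (run p q)" using i by (auto simp: run_def)
  ultimately show "z \<in> int ` set (run p q) \<union> (\<lambda>d. int (d + 1)) ` set (run p q)"
    using x(1) by blast
qed

text \<open>As \<open>k\<close> runs through 0, ..., 2h, so does \<open>\<pi> k\<close>, while
  \<open>k + \<pi> k\<close> runs through h, ..., 3h. The triples x, y, -(x + y + \<delta>)
  therefore fill three intervals of length \<open>F\<close>. The shift \<delta> will offset the
  surplus of an odd number of pairs of consecutive numbers.\<close>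

lemma kotzig_triples:
  fixes a b h \<delta> F :: nat
  defines "F \<equiv> 2 * h + 1"
  shows "\<exists>T::int list list. length T = F \<and> (\<forall>r\<in>set T. length r = 3 \<and> sum_list r = - int \<delta>) \<and>
    int ` ({a<..a + F} \<union> {b<..b + F} \<union> {a + b + h + 1 + \<delta><..a + b + h + 1 + \<delta> + F}) \<subseteq> abs ` set (concat T)"
proof -
  define \<pi> where "\<pi> k = (if k \<le> h then k + h else k - h - 1)" for k
  define t where "t k = [int (a + 1 + k), int (b + 1 + \<pi> k), - int (a + b + 2 + k + \<pi> k + \<delta>)]" for k
  define T where "T = map t [0..<F]"
  have t: "length (t k) = 3 \<and> sum_list (t k) = - int \<delta>" for k
    by (simp add: t_def)
  have mem: "int (a + 1 + k) \<in> abs ` set (concat T)" "int (b + 1 + \<pi> k) \<in> abs ` set (concat T)"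
    "int (a + b + 2 + k + \<pi> k + \<delta>) \<in> abs ` set (concat T)" if "k < F" for k
  proof -
    have "abs ` set (t k) \<subseteq> abs ` set (concat T)" using that by (intro image_mono) (auto simp: T_def)
    moreover have "abs ` set (t k) = {int (a + 1 + k), int (b + 1 + \<pi> k), int (a + b + 2 + k + \<pi> k + \<delta>)}"
      by (simp add: t_def algebra_simps)
    ultimately show "int (a + 1 + k) \<in> abs ` set (concat T)" "int (b + 1 + \<pi> k) \<in> abs ` set (concat T)"
      "int (a + b + 2 + k + \<pi> k + \<delta>) \<in> abs ` set (concat T)" by auto
  qed
  have "int x \<in> abs ` set (concat T)" if "x \<in> {a<..a + F}" for x
    using mem(1)[of "x - a - 1"] that by auto
  moreover have "int x \<in> abs ` set (concat T)" if "x \<in> {b<..b + F}" for x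
  proof -
    define v where "v = x - b - 1"
    define k where "k = (if h \<le> v then v - h else v + h + 1)"
    have "k < F" "\<pi> k = v" using that by (auto simp: k_def v_def \<pi>_def F_def)
    then show ?thesis using mem(2)[of k] that by (simp add: v_def)
  qed
  moreover have "int x \<in> abs ` set (concat T)"
    if "x \<in> {a + b + h + 1 + \<delta><..a + b + h + 1 + \<delta> + F}" for x
  proof -
    define v where "v = x - (a + b + h + 2 + \<delta>)"
    have v: "v \<le> 2 * h" "x = a + b + h + 2 + \<delta> + v" using that by (auto simp: v_def F_def)
    \<comment> \<open>Even offsets of the third interval come from \<open>k <= h\<close>, odd ones
      from \<open>k > h\<close>.\<close>
    define k where "k = (if even v then v div 2 else h + (v + 1) div 2)"
    have "k < F \<and> k + \<pi> k = h + v"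
    proof (cases "even v")
      case True
      then obtain u where "v = 2 * u" by blast
      then show ?thesis using v(1) by (simp add: k_def \<pi>_def F_def)
    next
      case False
      then obtain u where "v = 2 * u + 1" by (blast elim: oddE)
      then show ?thesis using v(1) by (simp add: k_def \<pi>_def F_def)
    qed
    then have "k < F" "k + \<pi> k = h + v" by auto
    moreover have "x = a + b + 2 + k + \<pi> k + \<delta>" using v(2) \<open>k + \<pi> k = h + v\<close> by simp
    ultimately show ?thesis using mem(3)[of k] by simp
  qed
  ultimately show ?thesis
    using t by (intro exI[of _ T]) (auto simp: T_def)
qed

section \<open>Filling the gaps of the core\<close>

text \<open>For the rectangle with $2E+3$ rows and $2H+1$ columns, \<^term>\<open>strips H E w\<close> says that there are
  $E$ rows $r$ as in the introduction covering the gaps of the core with $W=w+H+1$.\<close>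

definition strips :: "nat \<Rightarrow> nat \<Rightarrow> nat \<Rightarrow> bool" where
  "strips H E w \<longleftrightarrow> H \<le> w \<and> w \<le> H + E * (2 * H + 1) \<and> (\<exists>S. length S = E \<and>
    (\<forall>r\<in>set S. length r = 2 * H + 1 \<and> sum_list r = (0::int)) \<and>
    int ` ({H<..w} \<union> {w + (2 * H + 1)<..H + (2 * H + 1) + E * (2 * H + 1)}) \<subseteq> abs ` set (concat S))"

lemma runs_cover:
  assumes "\<forall>(p, q)\<in>set rs. p \<le> q \<and> even (q - p)"
  shows "\<exists>ds. 2 * length ds = (\<Sum>(p, q)\<leftarrow>rs. q - p) \<and>
    int ` (\<Union>(p, q)\<in>set rs. {p<..q}) \<subseteq> int ` set ds \<union> (\<lambda>d. int (d + 1)) ` set ds"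
  using assms
proof (induction rs)
  case Nil
  then show ?case by simp
next
  case (Cons r rs)
  obtain p q where r: "r = (p, q)" by fastforce
  obtain ds where ds: "2 * length ds = (\<Sum>(p, q)\<leftarrow>rs. q - p)"
    "int ` (\<Union>(p, q)\<in>set rs. {p<..q}) \<subseteq> int ` set ds \<union> (\<lambda>d. int (d + 1)) ` set ds"
    using Cons by auto
  have ev: "even (q - p)" using Cons.prems r by auto
  have "int ` (\<Union>(p, q)\<in>set (r # rs). {p<..q}) = int ` {p<..q} \<union> int ` (\<Union>(p, q)\<in>set rs. {p<..q})"
    by (simp add: r image_Un)
  also have "\<dots> \<subseteq> int ` set (run p q @ ds) \<union> (\<lambda>d. int (d + 1)) ` set (run p q @ ds)"
    using ds(2) run_cover[OF ev] unfolding set_append image_Un by blast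
  finally show ?case
    using ds(1) ev by (intro exI[of _ "run p q @ ds"]) (auto simp: r)
qed

text \<open>Reduces the construction to interval arithmetic: the triples in \<open>T\<close> account
  for \<open>X\<close>, and the runs of even length in \<open>rs\<close> hold exactly the 2(H - 1)
  further numbers needed per row. The triple sum -1 for even \<open>H\<close> offsets the odd number
  \<open>H - 1\<close> of pairs.\<close>

lemma stripsI:
  fixes H w :: nat and T :: "int list list" and rs :: "(nat \<times> nat) list"
  assumes "H \<ge> 2" "H \<le> w" "w \<le> H + length T * (2 * H + 1)"
    and T: "\<And>r. r \<in> set T \<Longrightarrow> length r = 3 \<and> sum_list r = - (if even H then 1 else 0)"
    and rs: "\<forall>(p, q)\<in>set rs. p \<le> q \<and> even (q - p)"
    and len: "(\<Sum>(p, q)\<leftarrow>rs. q - p) + 2 * length T = 2 * (length T * H)"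
    and X: "int ` X \<subseteq> abs ` set (concat T)"
    and cover: "{H<..w} \<union> {w + (2 * H + 1)<..H + (2 * H + 1) + length T * (2 * H + 1)}
      \<subseteq> X \<union> (\<Union>(p, q)\<in>set rs. {p<..q})"
  shows "strips H (length T) w"
proof -
  obtain ds where ds: "2 * length ds = (\<Sum>(p, q)\<leftarrow>rs. q - p)"
    "int ` (\<Union>(p, q)\<in>set rs. {p<..q}) \<subseteq> int ` set ds \<union> (\<lambda>d. int (d + 1)) ` set ds"
    using runs_cover[OF rs] by blast
  have "length ds = length T * (H - 1)"
    using len ds(1) by (simp add: diff_mult_distrib2)
  moreover have "- (if even H then 1 else 0) + (if even (H - 1) then 0 else int 1) = 0"
    using assms(1) by auto
  ultimately obtain S where S: "length S = length T"
    "\<forall>r\<in>set S. length r = 3 + 2 * (H - 1) \<and> sum_list r = 0"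
    "abs ` set (concat T) \<union> int ` set ds \<union> (\<lambda>d. int (d + 1)) ` set ds \<subseteq> abs ` set (concat S)"
    using extend_rows[OF T, where ?ds = ds and k = "H - 1" and e = 1] by blast
  have "3 + 2 * (H - 1) = 2 * H + 1" using assms(1) by simp
  moreover have "int ` ({H<..w} \<union> {w + (2 * H + 1)<..H + (2 * H + 1) + length T * (2 * H + 1)})
      \<subseteq> int ` X \<union> int ` (\<Union>(p, q)\<in>set rs. {p<..q})"
    using image_mono[OF cover, of int] by (simp only: image_Un)
  moreover have "\<dots> \<subseteq> abs ` set (concat S)"
    using X ds(2) S(3) by (meson Un_least Un_subset_iff subset_trans)
  ultimately show ?thesis
    unfolding strips_def using S(1,2) assms(2,3)
    by (intro conjI exI[of _ S]) (simp_all only: subset_trans)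
qed

text \<open>Each row is a triple $x$, $y$, $-z$ completed by $H-1$ pairs of consecutive numbers with alternating
  signs. The triples are placed such that the numbers left over form runs of even length; the
  four cases only differ in the position of the triples and of $w$ that achieves this.\<close>

lemma strips_mod4_1:
  fixes H h E :: nat
  assumes H: "H \<ge> 2" and h: "even h" and E: "E = 2 * h + 1"
  shows "\<exists>w. strips H E w"
proof -
  define \<delta> where "\<delta> = (if even H then 1 else 0 :: nat)"
  \<comment> \<open>With this \<open>a\<close> the first two intervals of triples end at
    \<open>w\<close> and the third starts directly behind the interval reserved for the core. Only
    the runs from \<open>H\<close> to \<open>a\<close> and from \<open>z + E\<close> to
    \<open>M\<close> remain; the first is even because \<open>h\<close> is.\<close>
  define a where "a = 2 * H + h + 1 - \<delta>"
  define w where "w = a + 2 * E"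
  define z where "z = a + (a + E) + h + 1 + \<delta>"
  \<comment> \<open>The largest absolute value in the rectangle, (mn - 1)/2 for m = 2E + 3 and n =
    2H + 1.\<close>
  define M where "M = H + (2 * H + 1) + E * (2 * H + 1)"
  obtain T where T: "length T = E" "\<forall>r\<in>set T. length r = 3 \<and> sum_list r = - int \<delta>"
    "int ` ({a<..a + E} \<union> {a + E<..a + E + E} \<union> {z<..z + E}) \<subseteq> abs ` set (concat T)"
    using kotzig_triples[of h \<delta> a "a + E"] unfolding E z_def by blast
  have M: "M = 3 * H + 1 + 2 * (E * H) + E" by (simp add: M_def algebra_simps)
  have \<delta>: "\<delta> \<le> 1" "even (H + \<delta> + 1)" by (auto simp: \<delta>_def)
  have z: "z = w + (2 * H + 1)" using \<delta>(1) by (simp add: z_def w_def a_def E)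
  have "H + h + 1 \<le> 2 * (E * H) - 2 * E + \<delta>"
  proof (cases "H = 2")
    case True then show ?thesis by (simp add: \<delta>_def E)
  next
    case False
    then obtain H' where H': "H = H' + 3" using H by (metis add.commute le_Suc_ex le_antisym not_less_eq_eq numeral_2_eq_2 numeral_3_eq_3)
    then show ?thesis by (simp add: E algebra_simps)
  qed
  moreover have "E * H \<ge> E" using H by simp
  ultimately have le: "z + E \<le> M" unfolding z M w_def a_def using \<delta>(1) by linarith
  have ev1: "even (a - H)" using \<delta> h unfolding a_def by presburger
  have aH: "H \<le> a" using \<delta>(1) by (simp add: a_def)
  have "even (M + z + E)" using \<delta> h unfolding M z w_def a_def E by (auto)
  then have ev2: "even (M - (z + E))" using le by (simp add: add.assoc)
  show ?thesis
  proof (intro exI, rule stripsI[where T = T and rs = "[(H, a), (z + E, M)]" and w = w, unfolded T(1), OF H])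
    show "int ` ({a<..a + E} \<union> {a + E<..a + E + E} \<union> {z<..z + E}) \<subseteq> abs ` set (concat T)" by (rule T(3))
    show "w \<le> H + E * (2 * H + 1)" using le z by (simp add: M_def)
  qed (use T(2) ev1 ev2 le aH \<delta>(1) M z in \<open>auto simp: w_def \<delta>_def M_def[symmetric]\<close>)
qed

text \<open>Here \<open>w\<close> is maximal, so the gap above the core interval is empty. The
  triples leave runs of lengths h + 1, H + \<delta> + 1 and \<open>w - (z + E)\<close>, all even for
  odd \<open>h\<close>.\<close>

lemma strips_mod4_3:
  fixes H h E :: nat
  assumes H: "H \<ge> 2" and h: "odd h" and E: "E = 2 * h + 1"
  shows "\<exists>w. strips H E w"
proof -
  define \<delta> where "\<delta> = (if even H then 1 else 0 :: nat)"
  define a where "a = H + h + 1"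
  define w where "w = H + E * (2 * H + 1)"
  define z where "z = a + (a + E) + h + 1 + \<delta>"
  obtain T where T: "length T = E" "\<forall>r\<in>set T. length r = 3 \<and> sum_list r = - int \<delta>"
    "int ` ({a<..a + E} \<union> {a + E<..a + E + E} \<union> {z<..z + E}) \<subseteq> abs ` set (concat T)"
    using kotzig_triples[of h \<delta> a "a + E"] unfolding E z_def by blast
  have w: "w = H + 2 * (E * H) + E" by (simp add: w_def algebra_simps)
  have \<delta>: "\<delta> \<le> 1" "even (H + \<delta> + 1)" by (auto simp: \<delta>_def)
  have z: "z = a + 2 * E + (H + \<delta> + 1)" by (simp add: z_def a_def E)
  obtain H' where H': "H = H' + 2" using H by (metis add.commute le_Suc_ex)
  have h1: "h \<ge> 1" using h by (cases h) auto
  have "H + h + 3 \<le> 2 * (E * H) - 2 * E" using h1 by (simp add: H' E algebra_simps)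
  moreover have "E * H \<ge> E" using H by simp
  ultimately have le: "z + E \<le> w" unfolding z w a_def using \<delta>(1) by linarith
  have "even (w + (z + E))" using \<delta> h unfolding w z a_def E by auto
  then have ev: "even (w - (z + E))" using le by (simp only: even_diff_nat) simp
  have ev': "even (z - (a + 2 * E))" using \<delta>(2) unfolding z by simp
  show ?thesis
  proof (intro exI, rule stripsI[where T = T and rs = "[(H, a), (a + 2 * E, z), (z + E, w)]" and w = w, unfolded T(1), OF H])
    show "int ` ({a<..a + E} \<union> {a + E<..a + E + E} \<union> {z<..z + E}) \<subseteq> abs ` set (concat T)" by (rule T(3))
    show "(\<Sum>(p, q)\<leftarrow>[(H, a), (a + 2 * E, z), (z + E, w)]. q - p) + 2 * E = 2 * (E * H)"
      using le z w by (simp add: a_def)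
    show "w \<le> H + E * (2 * H + 1)" by (simp add: w_def)
    show "\<forall>(p, q)\<in>set [(H, a), (a + 2 * E, z), (z + E, w)]. p \<le> q \<and> even (q - p)"
      using ev ev' le h unfolding z a_def by simp
    show "{H<..w} \<union> {w + (2 * H + 1)<..H + (2 * H + 1) + E * (2 * H + 1)}
      \<subseteq> ({a<..a + E} \<union> {a + E<..a + E + E} \<union> {z<..z + E}) \<union> (\<Union>(p, q)\<in>set [(H, a), (a + 2 * E, z), (z + E, w)]. {p<..q})"
      by (auto simp: w_def)
  qed (use T(2) le z in \<open>auto simp: \<delta>_def a_def\<close>)
qed

lemma cover_triple:
  assumes "int ` A \<subseteq> abs ` set (concat T)"
  shows "int ` (A \<union> {x, y, z}) \<subseteq> abs ` set (concat ([int x, int y, - int z] # T))"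
proof -
  have "abs ` set (concat ([int x, int y, - int z] # T)) = {int x, int y, int z} \<union> abs ` set (concat T)"
    by simp
  then show ?thesis using assms by auto
qed

text \<open>Kotzig triples come in odd number, so E - 1 of them are joined by one extra triple. Its
  members \<open>a + E\<close> and \<open>b + E\<close> prolong the first two intervals by one; the
  third member \<open>y\<close> lies beyond the last interval and leaves a run of even length h + 1
  before it.\<close>

lemma strips_mod4_0:
  fixes H h E :: nat
  assumes H: "H \<ge> 2" "odd H" and h: "odd h" and E: "E = 2 * h + 2"
  shows "\<exists>w. strips H E w"
proof -
  define F where "F = 2 * h + 1"
  define a where "a = 2 * H + 2 + h"
  define b where "b = a + E"
  define w where "w = b + E"
  define z where "z = a + b + h + 1"
  define y where "y = a + b + 2 * E"
  define M where "M = H + (2 * H + 1) + E * (2 * H + 1)"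
  obtain T where T: "length T = F" "\<forall>r\<in>set T. length r = 3 \<and> sum_list r = 0"
    "int ` ({a<..a + F} \<union> {b<..b + F} \<union> {z<..z + F}) \<subseteq> abs ` set (concat T)"
    using kotzig_triples[of h 0 a b] unfolding F_def z_def by auto
  define T' where "T' = [int (a + E), int (b + E), - int y] # T"
  have T': "length T' = E" "\<forall>r\<in>set T'. length r = 3 \<and> sum_list r = 0"
    using T(1,2) by (auto simp: T'_def E F_def y_def)
  define X where "X = {a<..a + F} \<union> {b<..b + F} \<union> {z<..z + F} \<union> {a + E, b + E, y}"
  have X: "int ` X \<subseteq> abs ` set (concat T')"
    using cover_triple[OF T(3)] unfolding X_def T'_def .
  have M: "M = 3 * H + 1 + 2 * (E * H) + E" by (simp add: M_def algebra_simps)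
  have z: "z = w + (2 * H + 1)" by (simp add: z_def w_def a_def b_def E)
  have y: "y = z + F + h + 2" by (simp add: y_def z_def F_def E)
  obtain H' where H': "H = H' + 2" using H(1) by (metis add.commute le_Suc_ex)
  have h1: "h \<ge> 1" using h by (cases h) auto
  have "H + 6 * h + 7 \<le> 2 * (E * H)" using h1 by (simp add: H' E algebra_simps)
  then have le: "y \<le> M" unfolding y z M w_def b_def a_def F_def using E by linarith
  have "even (M + y)" using H(2) h unfolding M y z w_def b_def a_def E F_def by auto
  then have ev: "even (M - y)" using le by (simp only: even_diff_nat) simp
  show ?thesis
  proof (intro exI, rule stripsI[where T = T' and rs = "[(H, a), (z + F, z + F + h + 1), (y, M)]" and w = w, unfolded T'(1), OF H(1) _ _ _ _ _ X])
    show "w \<le> H + E * (2 * H + 1)" using le y z unfolding M_def by linarith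
    show "(\<Sum>(p, q)\<leftarrow>[(H, a), (z + F, z + F + h + 1), (y, M)]. q - p) + 2 * E = 2 * (E * H)"
      using le unfolding y z w_def b_def a_def M F_def E by simp
    show "\<forall>(p, q)\<in>set [(H, a), (z + F, z + F + h + 1), (y, M)]. p \<le> q \<and> even (q - p)"
      using ev le h H(2) unfolding a_def by simp
    show "{H<..w} \<union> {w + (2 * H + 1)<..H + (2 * H + 1) + E * (2 * H + 1)}
      \<subseteq> X \<union> (\<Union>(p, q)\<in>set [(H, a), (z + F, z + F + h + 1), (y, M)]. {p<..q})"
      unfolding M_def[symmetric] z[symmetric] X_def
      by (auto simp: w_def b_def y F_def E)
  qed (use T'(2) H(2) in \<open>auto simp: w_def b_def a_def\<close>)
qed

text \<open>The extra triple is now \<open>z\<close>, \<open>w\<close>, \<open>z + w\<close>, whose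
  smaller members enclose the third interval, and the core interval follows \<open>w\<close>. The
  runs up to \<open>y\<close> have lengths h, H - 1 and 5h, which are even for odd \<open>H\<close>
  and even \<open>h\<close>.\<close>

lemma strips_mod4_2:
  fixes H h E :: nat
  assumes H: "H \<ge> 2" "odd H" and h: "even h" and E: "E = 2 * h + 2"
  shows "\<exists>w. strips H E w"
proof -
  define F where "F = 2 * h + 1"
  define a where "a = H + h"
  define b where "b = a + F"
  define z where "z = a + b + h + 1"
  define w where "w = z + F + 1"
  define y where "y = z + w"
  define M where "M = H + (2 * H + 1) + E * (2 * H + 1)"
  obtain T where T: "length T = F" "\<forall>r\<in>set T. length r = 3 \<and> sum_list r = 0"
    "int ` ({a<..a + F} \<union> {b<..b + F} \<union> {z<..z + F}) \<subseteq> abs ` set (concat T)"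
    using kotzig_triples[of h 0 a b] unfolding F_def z_def by auto
  define T' where "T' = [int z, int w, - int y] # T"
  have T': "length T' = E" "\<forall>r\<in>set T'. length r = 3 \<and> sum_list r = 0"
    using T(1,2) by (auto simp: T'_def E F_def y_def)
  define X where "X = {a<..a + F} \<union> {b<..b + F} \<union> {z<..z + F} \<union> {z, w, y}"
  have X: "int ` X \<subseteq> abs ` set (concat T')"
    using cover_triple[OF T(3)] unfolding X_def T'_def .
  have M: "M = 3 * H + 1 + 2 * (E * H) + E" by (simp add: M_def algebra_simps)
  have z: "z = b + F + H" by (simp add: z_def a_def b_def F_def)
  have y: "y = w + (2 * H + 1) + 5 * h + 1" by (simp add: y_def z_def a_def b_def F_def)
  obtain H' where H': "H = H' + 3"
    using H by (metis add.commute le_Suc_ex le_antisym not_less_eq_eq numeral_2_eq_2 numeral_3_eq_3 odd_numeral even_numeral)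
  have "H + 10 * h + 3 \<le> 2 * (E * H)" by (simp add: H' E algebra_simps)
  then have le: "y \<le> M" unfolding y z M w_def b_def a_def F_def using E by linarith
  have "even (M + y)" using H(2) h unfolding M y z w_def b_def a_def E F_def by auto
  then have ev: "even (M - y)" using le by (simp only: even_diff_nat) simp
  let ?rs = "[(H, a), (b + F, z - 1), (w + (2 * H + 1), y - 1), (y, M)]"
  show ?thesis
  proof (intro exI, rule stripsI[where T = T' and rs = ?rs and w = w, unfolded T'(1), OF H(1) _ _ _ _ _ X])
    show "w \<le> H + E * (2 * H + 1)" using le y unfolding M_def by linarith
    show "(\<Sum>(p, q)\<leftarrow>?rs. q - p) + 2 * E = 2 * (E * H)"
      using le H' unfolding y z w_def b_def a_def M F_def E by simp
    show "\<forall>(p, q)\<in>set ?rs. p \<le> q \<and> even (q - p)"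
      using ev le h H(2) H' unfolding a_def y z by simp
    show "{H<..w} \<union> {w + (2 * H + 1)<..H + (2 * H + 1) + E * (2 * H + 1)}
      \<subseteq> X \<union> (\<Union>(p, q)\<in>set ?rs. {p<..q})"
      unfolding M_def[symmetric] X_def
      by (auto simp: w_def b_def)
  qed (use T'(2) H(2) in \<open>auto simp: z w_def b_def a_def\<close>)
qed

lemma strips_none: "strips H 0 H"
  by (simp add: strips_def)

section \<open>The core\<close>

lemma sum_centered:
  fixes g :: "int \<Rightarrow> int"
  shows "(\<Sum>j<2 * H + 1. g (int j - int H)) = g 0 + (\<Sum>t=1..H. g (int t) + g (- int t))"
proof (induction H)
  case 0
  show ?case by simp
next
  case (Suc H)
  have "(\<Sum>j<2 * Suc H + 1. g (int j - int (Suc H))) =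
      g (- int (Suc H)) + (\<Sum>j<2 * H + 1. g (int j - int H)) + g (int (Suc H))"
  proof -
    have "2 * Suc H + 1 = Suc (Suc (2 * H + 1))" by simp
    then show ?thesis
      by (simp only: sum.lessThan_Suc_shift[of _ "Suc (2 * H + 1)"] sum.lessThan_Suc[of _ "2 * H + 1"])
        (simp add: algebra_simps)
  qed
  then show ?case using Suc.IH by simp
qed

lemma sum_alternating:
  fixes N :: nat
  shows "(\<Sum>t=2..<N + 2. if even t then c else - c) = (if odd N then c else (0::int))"
  by (induction N) auto

text \<open>The second row of a Kotzig array: exchanging the two halves of -H, ..., H gives a
  permutation whose sum with the identity is again a permutation of -H, ..., H.\<close>

definition kotzig2 :: "nat \<Rightarrow> int \<Rightarrow> int" where
  "kotzig2 H a = (if a \<le> 0 then a + int H else a - int H - 1)"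

text \<open>The three entries of column \<^term>\<open>a\<close> are \<^term>\<open>a\<close>, \<^term>\<open>kotzig2 H a + W\<close> and minus their sum;
  the four exceptional columns compensate the surplus of the alternating arrangement
  of the second and third entry in the others.\<close>

definition core :: "int \<Rightarrow> nat \<Rightarrow> int \<Rightarrow> nat \<Rightarrow> int" where
  "core W H a i = (let x = a; y = kotzig2 H a + W; z = - x - y in
    (if \<bar>a\<bar> = int H then if even H then [z, y, x] else [z, x, y]
     else if a = 0 then [y, x, z] else if a = 1 then [y, z, x]
     else if even a then [x, y, z] else [x, z, y]) ! i)"

lemma core_set:
  "core W H a ` {..<3} = {a, kotzig2 H a + W, - a - kotzig2 H a - W}"
proof -
  have "{..<3::nat} = {0, 1, 2}" by auto
  then show ?thesis by (simp add: core_def Let_def insert_commute diff_diff_eq)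
qed

lemma core_column_sum: "(\<Sum>i<3. core W H a i) = 0"
proof -
  have "{..<3::nat} = {0, 1, 2}" by auto
  then show ?thesis by (auto simp: core_def Let_def)
qed

text \<open>Columns \<open>t\<close> and \<open>- t\<close> are added up. For 2 <= t < H these pair
  sums are alternately \<open>c\<close> and \<open>- c\<close>, and the arrangement of the columns
  0, 1 and -H, H cancels what the alternation and column -1 leave over.\<close>

lemma core_row_sum:
  assumes "H \<ge> 2" "i < 3"
  shows "(\<Sum>j<2 * H + 1. core W H (int j - int H) i) = 0"
proof -
  obtain N where H: "H = N + 2" using assms(1) by (metis add.commute le_Suc_ex)
  define h where "h t = core W H (int t) i + core W H (- int t) i" for t
  \<comment> \<open>For t > 0 the values \<open>kotzig2 H t\<close> and
    \<open>kotzig2 H (- t)\<close> add up to -1, so a column pair contributes 2W - 1 to the row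
    holding its second entries.\<close>
  define c where "c = (if i = 0 then 0 else if i = 1 then 2 * W - 1 else 1 - 2 * W)"
  have i: "i = 0 \<or> i = 1 \<or> i = 2" using assms(2) by auto
  have mid: "h t = (if even t then c else - c)" if "t \<in> {2..<N + 2}" for t
    using that i by (auto simp: h_def c_def core_def Let_def kotzig2_def H)
  have "{1..H} = insert 1 (insert (N + 2) {2..<N + 2})" by (auto simp: H)
  then have "(\<Sum>t=1..H. h t) = h 1 + h (N + 2) + (\<Sum>t=2..<N + 2. h t)" by simp
  also have "(\<Sum>t=2..<N + 2. h t) = (\<Sum>t=2..<N + 2. if even t then c else - c)"
    by (rule sum.cong[OF refl mid])
  also have "\<dots> = (if odd N then c else 0)" by (rule sum_alternating)
  finally have "core W H 0 i + (\<Sum>t=1..H. h t) = 0"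
    using i by (auto simp: h_def c_def core_def Let_def kotzig2_def H)
  then show ?thesis using sum_centered[of "\<lambda>a. core W H a i" H] by (simp only: h_def)
qed

lemma kotzig2_surj:
  assumes "\<bar>y\<bar> \<le> int H"
  shows "\<exists>a. \<bar>a\<bar> \<le> int H \<and> kotzig2 H a = y"
proof (cases "y \<ge> 0")
  case True
  then show ?thesis using assms by (intro exI[of _ "y - int H"]) (auto simp: kotzig2_def)
next
  case False
  then show ?thesis using assms by (intro exI[of _ "y + int H + 1"]) (auto simp: kotzig2_def)
qed

text \<open>The sum \<open>a + kotzig2 H a\<close> is 2a + H for a <= 0 and 2a - H - 1 for a > 0.
  The two branches take opposite parities, so the parity of \<open>y + int H\<close> selects the
  branch.\<close>

lemma kotzig3_surj:
  assumes "\<bar>y\<bar> \<le> int H"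
  shows "\<exists>a. \<bar>a\<bar> \<le> int H \<and> - a - kotzig2 H a = y"
proof (cases "even (y + int H)")
  case True
  then obtain u where "y + int H = 2 * u" by blast
  then show ?thesis using assms by (intro exI[of _ "- u"]) (auto simp: kotzig2_def)
next
  case False
  then obtain u where "y + int H = 2 * u + 1" by (blast elim: oddE)
  then show ?thesis using assms by (intro exI[of _ "int H - u"]) (auto simp: kotzig2_def)
qed

lemma core_cover:
  assumes "\<bar>y\<bar> \<le> int H"
  shows "\<exists>i<3. \<exists>j<2 * H + 1. core W H (int j - int H) i = y"
    "\<exists>i<3. \<exists>j<2 * H + 1. core W H (int j - int H) i = y + W"
    "\<exists>i<3. \<exists>j<2 * H + 1. core W H (int j - int H) i = y - W"
proof -
  have *: "\<exists>i<3. \<exists>j<2 * H + 1. core W H (int j - int H) i = v"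
    if a: "\<bar>a\<bar> \<le> int H" and v: "v \<in> {a, kotzig2 H a + W, - a - kotzig2 H a - W}" for a v
  proof -
    obtain i where "i < 3" "core W H a i = v"
      using v unfolding core_set[of W H a, symmetric] by auto
    moreover have "nat (a + int H) < 2 * H + 1" "int (nat (a + int H)) - int H = a"
      using a by auto
    ultimately show ?thesis by metis
  qed
  show "\<exists>i<3. \<exists>j<2 * H + 1. core W H (int j - int H) i = y" using *[OF assms] by blast
  show "\<exists>i<3. \<exists>j<2 * H + 1. core W H (int j - int H) i = y + W"
    using kotzig2_surj[OF assms] * by blast
  obtain a where a: "\<bar>a\<bar> \<le> int H" "- a - kotzig2 H a = y" using kotzig3_surj[OF assms] by blast
  have "y - W \<in> {a, kotzig2 H a + W, - a - kotzig2 H a - W}" using a(2) by simp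
  then show "\<exists>i<3. \<exists>j<2 * H + 1. core W H (int j - int H) i = y - W" using *[OF a(1)] by blast
qed

section \<open>Assembling one rectangle with odd sides\<close>

lemma sum_paired_tail:
  fixes x :: "nat \<Rightarrow> int"
  assumes "\<And>g. g < E \<Longrightarrow> x (2 * g + 3) + x (2 * g + 4) = 0"
  shows "(\<Sum>i<2 * E + 3. x i) = (\<Sum>i<3. x i)"
  using assms
proof (induction E)
  case 0
  show ?case by simp
next
  case (Suc E)
  have "(\<Sum>i<2 * Suc E + 3. x i) = (\<Sum>i<2 * E + 3. x i) + (x (2 * E + 3) + x (2 * E + 4))"
    by (simp add: eval_nat_numeral)
  then show ?case using Suc by simp
qed

lemma sum_list_nth: "(\<Sum>j<length r. r ! j) = sum_list r"
  for r :: "int list"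
  by (simp add: sum_list_sum_nth atLeast0LessThan)

text \<open>Each row of \<open>S\<close> is used twice, once with either sign, below the core. This
  clears the columns and realises every gap value with both signs; the core supplies all remaining
  values.\<close>

lemma odd_rectangle_of_strips:
  assumes H: "H \<ge> 2" and "strips H E w"
  shows "\<exists>A::nat \<Rightarrow> nat \<Rightarrow> int. (\<forall>i<2 * E + 3. (\<Sum>j<2 * H + 1. A i j) = 0) \<and>
    (\<forall>j<2 * H + 1. (\<Sum>i<2 * E + 3. A i j) = 0) \<and>
    (\<forall>v. \<bar>v\<bar> \<le> int (H + (2 * H + 1) + E * (2 * H + 1)) \<longrightarrow> (\<exists>i<2 * E + 3. \<exists>j<2 * H + 1. A i j = v))"
proof -
  define n where "n = 2 * H + 1"
  define M where "M = H + n + E * n"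
  obtain S where w: "H \<le> w" and S: "length S = E" "\<forall>r\<in>set S. length r = n \<and> sum_list r = 0"
    "int ` ({H<..w} \<union> {w + n<..M}) \<subseteq> abs ` set (concat S)"
    using assms(2) unfolding strips_def M_def n_def by blast
  \<comment> \<open>The centre of the interval from \<open>w + 1\<close> to \<open>w + n\<close>,
    which the strips leave free.\<close>
  define W where "W = int (w + H + 1)"
  define A where "A i j = (if i < 3 then core W H (int j - int H) i
    else (if odd i then 1 else - 1) * S ! ((i - 3) div 2) ! j)" for i j
  have row: "(\<Sum>j<n. A i j) = 0" if "i < 2 * E + 3" for i
  proof (cases "i < 3")
    case True
    then show ?thesis using core_row_sum[OF H] by (simp add: A_def n_def)
  next
    case False
    have "S ! ((i - 3) div 2) \<in> set S" using that False S(1) by (intro nth_mem) auto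
    then have "(\<Sum>j<n. S ! ((i - 3) div 2) ! j) = 0" using S(2) sum_list_nth by metis
    then show ?thesis using False by (simp add: A_def sum_negf)
  qed
  have column: "(\<Sum>i<2 * E + 3. A i j) = 0" for j
  proof -
    have "(\<Sum>i<2 * E + 3. A i j) = (\<Sum>i<3. A i j)"
      by (rule sum_paired_tail) (auto simp: A_def)
    also have "\<dots> = (\<Sum>i<3. core W H (int j - int H) i)" by (simp add: A_def)
    finally show ?thesis by (simp add: core_column_sum)
  qed
  have core: "\<exists>i<2 * E + 3. \<exists>j<n. A i j = v" if c: "\<exists>i<3. \<exists>j<2 * H + 1. core W H (int j - int H) i = v" for v
  proof -
    obtain i j where ij: "i < 3" "j < n" "core W H (int j - int H) i = v"
      using c unfolding n_def by blast
    then have "i < 2 * E + 3" "A i j = v" by (auto simp: A_def)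
    then show ?thesis using ij(2) by blast
  qed
  have strip: "\<exists>i<2 * E + 3. \<exists>j<n. A i j = v" if "nat \<bar>v\<bar> \<in> {H<..w} \<union> {w + n<..M}" for v
  proof -
    have "int (nat \<bar>v\<bar>) \<in> abs ` set (concat S)" using that S(3) by blast
    then have "\<bar>v\<bar> \<in> abs ` set (concat S)" by simp
    then obtain r u where r: "r \<in> set S" "u \<in> set r" "\<bar>v\<bar> = \<bar>u\<bar>" by auto
    obtain g where g: "g < E" "S ! g = r" using r(1) S(1) by (metis in_set_conv_nth)
    obtain j where j: "j < n" "r ! j = u" using r(1,2) S(2) by (metis in_set_conv_nth)
    have "A (2 * g + 3) j = u" "A (2 * g + 4) j = - u" using g j by (auto simp: A_def)
    moreover have "v = u \<or> v = - u" using r(3) by linarith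
    moreover have "2 * g + 3 < 2 * E + 3" "2 * g + 4 < 2 * E + 3" using g(1) by auto
    ultimately show ?thesis using j(1) by blast
  qed
  have cover: "\<exists>i<2 * E + 3. \<exists>j<n. A i j = v" if v: "\<bar>v\<bar> \<le> int M" for v
  proof (cases "nat \<bar>v\<bar> \<in> {H<..w} \<union> {w + n<..M}")
    case True
    then show ?thesis by (rule strip)
  next
    case False
    consider "\<bar>v\<bar> \<le> int H" | "\<bar>v - W\<bar> \<le> int H" | "\<bar>v + W\<bar> \<le> int H"
    proof -
      have "nat \<bar>v\<bar> \<le> H \<or> w < nat \<bar>v\<bar> \<and> nat \<bar>v\<bar> \<le> w + n"
        using False v by auto
      then have "\<bar>v\<bar> \<le> int H \<or> int w < \<bar>v\<bar> \<and> \<bar>v\<bar> \<le> int (w + n)" by linarith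
      then have "\<bar>v\<bar> \<le> int H \<or> \<bar>v - W\<bar> \<le> int H \<or> \<bar>v + W\<bar> \<le> int H"
        unfolding W_def n_def by linarith
      then show thesis using that by blast
    qed
    then show ?thesis
    proof cases
      case 1
      then show ?thesis using core core_cover(1) by blast
    next
      case 2
      from core[OF core_cover(2)[OF this]] show ?thesis by simp
    next
      case 3
      from core[OF core_cover(3)[OF this]] show ?thesis by simp
    qed
  qed
  show ?thesis using row column cover unfolding M_def n_def by blast
qed

section \<open>Magic rectangle sets\<close>

text \<open>The numbers $1, \dots, cmn$ are represented by their deviation $2x - (cmn + 1)$ from the mean, so
  that magic sums become zero sums; hitting every value implies injectivity by counting.\<close>

definition magic_rectangle_set :: "nat \<Rightarrow> nat \<Rightarrow> nat \<Rightarrow> bool" where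
  "magic_rectangle_set m n c \<longleftrightarrow> (\<exists>G::nat \<Rightarrow> nat \<Rightarrow> nat \<Rightarrow> int.
    (\<forall>k<c. \<forall>i<m. (\<Sum>j<n. G k i j) = 0) \<and> (\<forall>k<c. \<forall>j<n. (\<Sum>i<m. G k i j) = 0) \<and>
    (\<forall>x\<in>{1..c * m * n}. \<exists>k<c. \<exists>i<m. \<exists>j<n. G k i j = 2 * int x - int (c * m * n) - 1))"

lemma magic_rectangle_set_transpose:
  assumes "magic_rectangle_set m n c"
  shows "magic_rectangle_set n m c"
proof -
  obtain G :: "nat \<Rightarrow> nat \<Rightarrow> nat \<Rightarrow> int" where G: "\<forall>k<c. \<forall>i<m. (\<Sum>j<n. G k i j) = 0"
    "\<forall>k<c. \<forall>j<n. (\<Sum>i<m. G k i j) = 0"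
    "\<forall>x\<in>{1..c * m * n}. \<exists>k<c. \<exists>i<m. \<exists>j<n. G k i j = 2 * int x - int (c * m * n) - 1"
    using assms unfolding magic_rectangle_set_def by blast
  have "c * m * n = c * n * m" by simp
  then have "\<forall>x\<in>{1..c * n * m}. \<exists>k<c. \<exists>j<n. \<exists>i<m. G k i j = 2 * int x - int (c * n * m) - 1"
    using G(3) by metis
  then show ?thesis
    unfolding magic_rectangle_set_def using G(1,2)
    by (intro exI[of _ "\<lambda>k j i. G k i j"]) auto
qed

section \<open>Copies by means of a Kotzig digit\<close>

definition kotzig :: "nat \<Rightarrow> nat \<Rightarrow> int \<Rightarrow> int" where
  "kotzig h l a = (if l = 0 then a else if l = 1 then kotzig2 h a else - a - kotzig2 h a)"

lemma kotzig_surj: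
  assumes "\<bar>y\<bar> \<le> int h"
  shows "\<exists>a. \<bar>a\<bar> \<le> int h \<and> kotzig h l a = y"
  using assms kotzig2_surj[OF assms] kotzig3_surj[OF assms] by (auto simp: kotzig_def)

definition tail_sign :: "nat \<Rightarrow> int" where
  "tail_sign i = (if i < 3 \<or> odd i then 1 else - 1)"

text \<open>Three permutations with sum zero, arranged in a Latin square of order 3 and continued by pairs of
  rows and columns of opposite sign.\<close>

definition kotzig_cell :: "nat \<Rightarrow> nat \<Rightarrow> nat \<Rightarrow> int \<Rightarrow> int" where
  "kotzig_cell h i j a = tail_sign i * tail_sign j *
    kotzig h (if i < 3 \<and> j < 3 then (i + j) mod 3 else if i < 3 then i else if j < 3 then j else 0) a"

lemma kotzig_cell_commute: "kotzig_cell h i j = kotzig_cell h j i"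
  by (intro ext) (auto simp: kotzig_cell_def add.commute)

lemma kotzig_cell_surj:
  assumes "\<bar>y\<bar> \<le> int h"
  shows "\<exists>a. \<bar>a\<bar> \<le> int h \<and> kotzig_cell h i j a = y"
proof -
  define s where "s = tail_sign i * tail_sign j"
  have s: "s = 1 \<or> s = - 1" by (auto simp: s_def tail_sign_def)
  then have "\<bar>s * y\<bar> \<le> int h" using assms by auto
  then obtain a where "\<bar>a\<bar> \<le> int h"
    "kotzig h (if i < 3 \<and> j < 3 then (i + j) mod 3 else if i < 3 then i else if j < 3 then j else 0) a = s * y"
    using kotzig_surj by blast
  then have "kotzig_cell h i j a = y" using s by (auto simp: kotzig_cell_def s_def[symmetric])
  then show ?thesis using \<open>\<bar>a\<bar> \<le> int h\<close> by blast
qed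

text \<open>Up to a common sign, the first three entries run through the three permutations, whose
  sum is zero; the later entries cancel in pairs.\<close>

lemma kotzig_cell_row_sum: "(\<Sum>j<2 * E + 3. kotzig_cell h i j a) = 0"
proof -
  have "(\<Sum>j<2 * E + 3. kotzig_cell h i j a) = (\<Sum>j<3. kotzig_cell h i j a)"
    by (rule sum_paired_tail) (auto simp: kotzig_cell_def tail_sign_def)
  also have "\<dots> = kotzig_cell h i 0 a + kotzig_cell h i 1 a + kotzig_cell h i 2 a"
    by (simp add: eval_nat_numeral)
  also have "\<dots> = 0"
  proof (cases "i < 3")
    case True
    then consider "i = 0" | "i = 1" | "i = 2" by linarith
    then show ?thesis by cases (auto simp: kotzig_cell_def tail_sign_def kotzig_def)
  next
    case False
    then show ?thesis by (auto simp: kotzig_cell_def tail_sign_def kotzig_def)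
  qed
  finally show ?thesis .
qed

text \<open>Numbers are written in base 2h + 1 with digits -h, ..., h: \<open>A\<close> is the
  leading part, and the copy number determines the last digit through \<open>kotzig_cell\<close>. In
  every cell this digit is a permutation of the copies, so all values occur; both parts have zero
  row and column sums.\<close>

lemma magic_rectangle_set_of_strips:
  assumes H: "H \<ge> 2" and "strips H E w"
  shows "magic_rectangle_set (2 * E + 3) (2 * H + 1) (2 * h + 1)"
proof -
  define m where "m = 2 * E + 3"
  define n where "n = 2 * H + 1"
  define c where "c = 2 * h + 1"
  define M where "M = H + n + E * n"
  obtain A :: "nat \<Rightarrow> nat \<Rightarrow> int" where A: "\<forall>i<m. (\<Sum>j<n. A i j) = 0" "\<forall>j<n. (\<Sum>i<m. A i j) = 0"
    "\<forall>v. \<bar>v\<bar> \<le> int M \<longrightarrow> (\<exists>i<m. \<exists>j<n. A i j = v)"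
    using odd_rectangle_of_strips[OF assms] unfolding m_def n_def M_def by blast
  \<comment> \<open>The factor 2 appears because \<open>c * m * n\<close> is odd, so that all
    deviations are even.\<close>
  define G where "G k i j = 2 * (int c * A i j + kotzig_cell h i j (int k - int h))" for k i j
  obtain E' where E': "n = 2 * E' + 3" using H unfolding n_def
    by (metis add.commute add_2_eq_Suc' add_Suc_right le_Suc_ex mult_Suc_right numeral_3_eq_3 plus_1_eq_Suc Suc_1 numeral_2_eq_2)
  have row: "(\<Sum>j<n. G k i j) = 0" if "i < m" for k i
    using A(1) that kotzig_cell_row_sum[of h i _ E'] unfolding E'[symmetric]
    by (simp add: G_def sum.distrib flip: sum_distrib_left)
  have col: "(\<Sum>i<m. G k i j) = 0" if "j < n" for k j
    using A(2) that kotzig_cell_row_sum[of h j _ E] unfolding m_def[symmetric]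
    by (simp add: G_def kotzig_cell_commute[of h _ j] sum.distrib flip: sum_distrib_left)
  have cmn: "int (c * m * n) = 2 * (int c * int M + int h) + 1"
    by (simp add: c_def m_def n_def M_def algebra_simps)
  have surj: "\<exists>k<c. \<exists>i<m. \<exists>j<n. G k i j = 2 * int x - int (c * m * n) - 1" if x: "x \<in> {1..c * m * n}" for x
  proof -
    define u where "u = int x - int c * int M - int h - 1"
    have "1 \<le> int x" "int x \<le> 2 * (int c * int M + int h) + 1"
      using x unfolding cmn[symmetric] of_nat_le_iff by auto
    then have "- (int c * int M) - int h \<le> u \<and> u \<le> int c * int M + int h"
      unfolding u_def by (auto simp: algebra_simps)
    then have u: "- (int c * int M) - int h \<le> u" "u \<le> int c * int M + int h" by auto
    \<comment> \<open>Here \<open>u\<close> is half the deviation. Adding \<open>h\<close> before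
      the division turns the remainder into the balanced digit \<open>r - int h\<close>.\<close>
    define q where "q = (u + int h) div int c"
    define r where "r = (u + int h) mod int c"
    have qr: "u + int h = int c * q + r" unfolding q_def r_def by simp
    have r: "0 \<le> r" "r < int c" unfolding r_def c_def by simp_all
    have "q \<le> int M"
    proof (rule ccontr)
      assume "\<not> q \<le> int M"
      then have "int c * (int M + 1) \<le> int c * q" by (intro mult_left_mono) auto
      then show False using qr r(1) u(2) by (simp add: c_def algebra_simps)
    qed
    moreover have "- int M \<le> q"
    proof (rule ccontr)
      assume "\<not> - int M \<le> q"
      then have "int c * q \<le> int c * (- int M - 1)" by (intro mult_left_mono) auto
      then show False using qr r(2) u(1) by (simp add: algebra_simps)
    qed
    ultimately have "\<bar>q\<bar> \<le> int M" by linarith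
    then obtain i j where ij: "i < m" "j < n" "A i j = q" using A(3) by blast
    have "\<bar>r - int h\<bar> \<le> int h" using r unfolding c_def by auto
    then obtain a where a: "\<bar>a\<bar> \<le> int h" "kotzig_cell h i j a = r - int h"
      using kotzig_cell_surj by blast
    have k: "nat (a + int h) < c" "int (nat (a + int h)) - int h = a"
      using a(1) unfolding c_def by linarith+
    have "G (nat (a + int h)) i j = 2 * u"
      using qr by (simp only: G_def k(2) ij(3) a(2)) simp
    also have "\<dots> = 2 * int x - int (c * m * n) - 1" unfolding cmn u_def by simp
    finally show ?thesis using k(1) ij(1,2) by blast
  qed
  have "magic_rectangle_set m n c"
    unfolding magic_rectangle_set_def using row col surj by blast
  then show ?thesis by (simp only: m_def n_def c_def)
qed

lemma ex_strips:
  assumes "H \<ge> 2" "E = 0 \<or> odd E \<or> odd H"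
  shows "\<exists>w. strips H E w"
proof (cases "odd E")
  case True
  then obtain h where "E = 2 * h + 1" by (blast elim: oddE)
  then show ?thesis using strips_mod4_1[OF assms(1)] strips_mod4_3[OF assms(1)] by (cases "even h") auto
next
  case False
  show ?thesis
  proof (cases "E = 0")
    case True
    then show ?thesis using strips_none by blast
  next
    case E: False
    then obtain h where "E = 2 * h + 2" using False by (metis add_2_eq_Suc' dvdE mult_Suc_right mult_0_right not0_implies_Suc add.commute)
    then show ?thesis using assms E False strips_mod4_0[OF assms(1)] strips_mod4_2[OF assms(1)] by (cases "even h") auto
  qed
qed

text \<open>With m = 2 Hm + 1 there are \<open>Hm - 1\<close> signed pairs of rows below the core.
  The case left open by \<open>ex_strips\<close> is an even positive number of pairs with
  \<open>Hn\<close> even; the transposed rectangle then has the odd number \<open>Hn - 1\<close> of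
  pairs.\<close>

lemma magic_rectangle_set_odd:
  assumes "odd m" "odd n" "odd c" "m \<ge> 3" "n \<ge> 5"
  shows "magic_rectangle_set m n c"
proof -
  obtain h where h: "c = 2 * h + 1" using assms(3) by (blast elim: oddE)
  have main: "magic_rectangle_set (2 * E + 3) (2 * H + 1) c" if "H \<ge> 2" "E = 0 \<or> odd E \<or> odd H" for H E
    using ex_strips[OF that] magic_rectangle_set_of_strips[OF that(1)] h by blast
  obtain Hm where m: "m = 2 * Hm + 1" using assms(1) by (blast elim: oddE)
  obtain Hn where n: "n = 2 * Hn + 1" using assms(2) by (blast elim: oddE)
  have mE: "m = 2 * (Hm - 1) + 3" using assms(4) m by simp
  have nE: "n = 2 * (Hn - 1) + 3" using assms(5) n by simp
  show ?thesis
  proof (cases "even Hm \<or> odd Hn \<or> Hm = 1")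
    case True
    then have "magic_rectangle_set (2 * (Hm - 1) + 3) (2 * Hn + 1) c"
      using assms(4,5) m n by (intro main) auto
    then show ?thesis using mE n by simp
  next
    case False
    then have "magic_rectangle_set (2 * (Hn - 1) + 3) (2 * Hm + 1) c"
      using assms(4,5) m n by (intro main) auto
    then show ?thesis using nE m by (simp add: magic_rectangle_set_transpose)
  qed
qed

section \<open>Rectangles with even sides\<close>

text \<open>Six consecutive odd numbers never split into two triples of equal sum, by parity, so two
  rows at a time are formed from twelve. Three plus and three minus signs per row make its sum
  independent of the starting point.\<close>

lemma six_columns:
  "\<exists>T::int list list. length T = C \<and> (\<forall>r\<in>set T. length r = 6 \<and> sum_list r = 0) \<and>
    (\<forall>x<C * 6. int (2 * x + 1) \<in> abs ` set (concat T))"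
proof (induction C rule: nat_induct2)
  case 0
  show ?case by simp
next
  case 1
  have "x < 6 \<Longrightarrow> x \<in> {0, 1, 2, 3, 4, 5}" for x :: nat by auto
  \<comment> \<open>The single row rests on 1 + 3 + 5 + 9 = 7 + 11.\<close>
  then show ?case by (intro exI[of _ "[[1, 3, 5, - 7, 9, - 11]]"]) force
next
  case (step C)
  then obtain T :: "int list list" where T: "length T = C" "\<forall>r\<in>set T. length r = 6 \<and> sum_list r = 0"
    "\<forall>x<C * 6. int (2 * x + 1) \<in> abs ` set (concat T)" by blast
  define v where "v d = 12 * int C + 2 * d + 1" for d
  define r1 where "r1 = [v 0, v 4, v 5, - v 1, - v 2, - v 6]"
  define r2 where "r2 = [v 3, v 10, v 11, - v 7, - v 8, - v 9]"
  define T' where "T' = r1 # r2 # T"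
  have "int (2 * x + 1) \<in> abs ` set (concat T')" if "x < (C + 2) * 6" for x
  proof (cases "x < C * 6")
    case True
    then have "int (2 * x + 1) \<in> abs ` set (concat T)" using T(3) by blast
    moreover have "abs ` set (concat T) \<subseteq> abs ` set (concat T')"
      by (intro image_mono) (auto simp: T'_def)
    ultimately show ?thesis by blast
  next
    case False
    define d where "d = x - C * 6"
    have d: "d < 12" "int (2 * x + 1) = v (int d)" using False that by (auto simp: d_def v_def)
    have "d \<in> {0, 1, 2, 3, 4, 5, 6, 7, 8, 9, 10, 11}" using d(1) unfolding insert_iff empty_iff by presburger
    moreover have "abs ` set (r1 @ r2) \<subseteq> abs ` set (concat T')"
      by (intro image_mono) (auto simp: T'_def)
    moreover have "abs ` set (r1 @ r2) = v ` {0, 4, 5, 1, 2, 6, 3, 10, 11, 7, 8, 9}"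
      by (simp add: r1_def r2_def v_def ac_simps)
    ultimately show ?thesis unfolding d(2) by auto
  qed
  moreover have "length T' = C + 2" "\<forall>r\<in>set T'. length r = 6 \<and> sum_list r = 0"
    using T(1,2) by (auto simp: T'_def r1_def r2_def v_def)
  ultimately show ?case by blast
qed

text \<open>An initial segment of 0 or 6 columns, according to \<open>n\<close> modulo 4, leaves a
  multiple of four columns. They hold an even number of pairs \<open>d\<close>, \<open>d + 2\<close>
  per row, so the surpluses cancel.\<close>

lemma even_strips:
  assumes "even n" "n \<ge> 4"
  shows "\<exists>S::int list list. length S = C \<and> (\<forall>r\<in>set S. length r = n \<and> sum_list r = 0) \<and>
    (\<forall>x<C * n. int (2 * x + 1) \<in> abs ` set (concat S))"
proof -
  have "\<exists>l T. n = l + 2 * (2 * ((n - l) div 4)) \<and> length T = C \<and> (\<forall>r\<in>set T. length r = l \<and> sum_list r = (0::int)) \<and>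
    (\<forall>x<C * l. int (2 * x + 1) \<in> abs ` set (concat T))"
  proof (cases "4 dvd n")
    case True
    then show ?thesis by (intro exI[of _ 0] exI[of _ "replicate C []"]) auto
  next
    case False
    then have "n = 6 + 2 * (2 * ((n - 6) div 4))" using assms by presburger
    then show ?thesis using six_columns[of C] by blast
  qed
  then obtain l k and T :: "int list list" where n: "n = l + 2 * (2 * k)"
    and T: "length T = C" "\<And>r. r \<in> set T \<Longrightarrow> length r = l \<and> sum_list r = 0"
      "\<forall>x<C * l. int (2 * x + 1) \<in> abs ` set (concat T)"
    by blast
  define ds where "ds = map (\<lambda>i. 2 * (C * l) + 4 * i + 1) [0..<C * (2 * k)]"
  have ds: "length ds = length T * (2 * k)" using T(1) by (simp add: ds_def)
  obtain S where S: "length S = C" "\<forall>r\<in>set S. length r = n \<and> sum_list r = 0"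
    "abs ` set (concat T) \<union> int ` set ds \<union> (\<lambda>d. int (d + 2)) ` set ds \<subseteq> abs ` set (concat S)"
    using extend_rows[OF T(2) ds, where e = 2] unfolding T(1) n by auto
  have "int (2 * x + 1) \<in> abs ` set (concat S)" if "x < C * n" for x
  proof (cases "x < C * l")
    case True
    then show ?thesis using T(3) S(3) by blast
  next
    case False
    define i where "i = (x - C * l) div 2"
    have "x - C * l < 2 * (C * (2 * k))" using that False by (simp add: n algebra_simps)
    then have i: "i < C * (2 * k)" unfolding i_def by linarith
    have "2 * x + 1 = 2 * (C * l) + 4 * i + 1 \<or> 2 * x + 1 = 2 * (C * l) + 4 * i + 1 + 2"
      using False unfolding i_def by presburger
    moreover have "2 * (C * l) + 4 * i + 1 \<in> set ds" using i by (auto simp: ds_def)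
    ultimately have "int (2 * x + 1) \<in> int ` set ds \<union> (\<lambda>d. int (d + 2)) ` set ds"
      by (elim disjE) (simp_all only: image_eqI UnI1 UnI2)
    then show ?thesis using S(3) by blast
  qed
  then show ?thesis using S(1,2) by blast
qed

text \<open>The deviations are now the odd numbers of absolute value below cmn. The cm/2 strips of
  length \<open>n\<close> carry these absolute values, and each strip fills two consecutive rows
  with opposite signs.\<close>

lemma magic_rectangle_set_even:
  assumes "even m" "even n" "n \<ge> 4"
  shows "magic_rectangle_set m n c"
proof -
  obtain l where m: "m = 2 * l" using assms(1) by blast
  obtain S :: "int list list" where S: "length S = c * l" "\<forall>r\<in>set S. length r = n \<and> sum_list r = 0"
    "\<forall>x<c * l * n. int (2 * x + 1) \<in> abs ` set (concat S)"
    using even_strips[OF assms(2,3), of "c * l"] by blast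
  define G where "G k i j = (if even i then 1 else - 1) * S ! (k * l + i div 2) ! j" for k i j
  have row: "(\<Sum>j<n. G k i j) = 0" if "k < c" "i < m" for k i
  proof -
    have "k * l + i div 2 < (k + 1) * l" using that(2) m by auto
    also have "\<dots> \<le> c * l" using that(1) by (intro mult_right_mono) auto
    finally have "S ! (k * l + i div 2) \<in> set S" using S(1) by auto
    then have "(\<Sum>j<n. S ! (k * l + i div 2) ! j) = 0" using S(2) sum_list_nth by metis
    then show ?thesis by (simp add: G_def sum_negf)
  qed
  have col: "(\<Sum>i<m. G k i j) = 0" for k j
    unfolding m by (induction l) (auto simp: G_def)
  have surj: "\<exists>k<c. \<exists>i<m. \<exists>j<n. G k i j = 2 * int x - int (c * m * n) - 1" if "x \<in> {1..c * m * n}" for x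
  proof -
    define v where "v = 2 * int x - int (c * m * n) - 1"
    define N where "N = c * l * n"
    have N: "c * m * n = 2 * N" by (simp add: m N_def)
    define y where "y = nat ((\<bar>v\<bar> - 1) div 2)"
    have x: "1 \<le> int x" "int x \<le> 2 * int N" using that N by auto
    have "y < N \<and> \<bar>v\<bar> = int (2 * y + 1)"
    proof (cases "x \<le> N")
      case True
      then have "\<bar>v\<bar> = 2 * (int N - int x) + 1" unfolding v_def N by simp
      then show ?thesis using True x by (auto simp: y_def)
    next
      case False
      then have "\<bar>v\<bar> = 2 * (int x - int N - 1) + 1" unfolding v_def N by simp
      then show ?thesis using False x by (auto simp: y_def)
    qed
    then have "\<bar>v\<bar> \<in> abs ` set (concat S)" using S(3) unfolding N_def by metis
    then obtain r u where r: "r \<in> set S" "u \<in> set r" "\<bar>v\<bar> = \<bar>u\<bar>" by auto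
    obtain g where g: "g < c * l" "S ! g = r" using r(1) S(1) by (metis in_set_conv_nth)
    obtain j where j: "j < n" "r ! j = u" using r(1,2) S(2) by (metis in_set_conv_nth)
    have l: "l > 0" using g(1) by (cases l) auto
    have k: "g div l < c" using g(1) l by (simp add: less_mult_imp_div_less)
    have "G (g div l) (2 * (g mod l)) j = u" "G (g div l) (2 * (g mod l) + 1) j = - u"
      using g(2) j(2) by (auto simp: G_def)
    moreover have "v = u \<or> v = - u" using r(3) by linarith
    moreover have "g mod l < l" using l by simp
    then have "2 * (g mod l) < m" "2 * (g mod l) + 1 < m" unfolding m by linarith+
    ultimately show ?thesis using j(1) k unfolding v_def by metis
  qed
  show ?thesis unfolding magic_rectangle_set_def using row col surj by blast
qed

section \<open>The strong product\<close>

lemma verts_product: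
  "verts (strong_product (copies a (complete_multipartite m p)) (copies b (complete_multipartite n q))) =
    ({..<a} \<times> {..<p} \<times> {..<m}) \<times> ({..<b} \<times> {..<q} \<times> {..<n})"
  by (simp add: verts_def strong_product_def copies_def complete_multipartite_def atLeast0LessThan)

text \<open>The three clauses of the strong product split the neighbourhood into disjoint products,
  where \<open>A\<close> and \<open>B\<close> are the neighbourhoods of the two coordinates in their
  factors.\<close>

lemma sum_nbhd_product:
  fixes F :: "((nat \<times> nat \<times> nat) \<times> (nat \<times> nat \<times> nat)) \<Rightarrow> 'c::comm_monoid_add"
  assumes "\<alpha> < a" "i < p" "s < m" "\<beta> < b" "j < q" "t < n"
  shows "(\<Sum>y\<in>nbhd (strong_product (copies a (complete_multipartite m p))
        (copies b (complete_multipartite n q))) ((\<alpha>, i, s), (\<beta>, j, t)). F y) =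
    (\<Sum>j'\<in>{..<q} - {j}. \<Sum>t'<n. F ((\<alpha>, i, s), (\<beta>, j', t'))) +
    (\<Sum>i'\<in>{..<p} - {i}. \<Sum>s'<m. F ((\<alpha>, i', s'), (\<beta>, j, t))) +
    (\<Sum>i'\<in>{..<p} - {i}. \<Sum>s'<m. \<Sum>j'\<in>{..<q} - {j}. \<Sum>t'<n. F ((\<alpha>, i', s'), (\<beta>, j', t')))"
proof -
  define A where "A = {\<alpha>} \<times> ({..<p} - {i}) \<times> {..<m}"
  define B where "B = {\<beta>} \<times> ({..<q} - {j}) \<times> {..<n}"
  have nb: "nbhd (strong_product (copies a (complete_multipartite m p))
      (copies b (complete_multipartite n q))) ((\<alpha>, i, s), (\<beta>, j, t)) =
      {(\<alpha>, i, s)} \<times> B \<union> A \<times> {(\<beta>, j, t)} \<union> A \<times> B"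
    using assms
    by (auto simp: nbhd_def verts_product A_def B_def)
      (auto simp: adj_def strong_product_def copies_def complete_multipartite_def)
  have fin: "finite A" "finite B" by (simp_all add: A_def B_def)
  have sA: "sum g A = (\<Sum>i'\<in>{..<p} - {i}. \<Sum>s'<m. g (\<alpha>, i', s'))" for g :: "_ \<Rightarrow> 'c"
    by (simp add: A_def sum.cartesian_product')
  have sB: "sum g B = (\<Sum>j'\<in>{..<q} - {j}. \<Sum>t'<n. g (\<beta>, j', t'))" for g :: "_ \<Rightarrow> 'c"
    by (simp add: B_def sum.cartesian_product')
  have "sum F ({(\<alpha>, i, s)} \<times> B \<union> A \<times> {(\<beta>, j, t)} \<union> A \<times> B) =
      sum F ({(\<alpha>, i, s)} \<times> B) + sum F (A \<times> {(\<beta>, j, t)}) + sum F (A \<times> B)"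
    using fin by (subst sum.union_disjoint, auto simp: A_def B_def)+
  then show ?thesis
    unfolding nb by (simp add: sA sB sum.cartesian_product')
qed

section \<open>Necessity of the parity condition\<close>

text \<open>Every entry equals the total \<open>S\<close>, hence S = pS and S = 0. This is the
  invertibility of the adjacency matrix of a complete graph.\<close>

lemma zero_of_deleted_sums:
  fixes D :: "nat \<Rightarrow> int"
  assumes "p > 1" "\<And>i. i < p \<Longrightarrow> (\<Sum>i'\<in>{..<p} - {i}. D i') = 0" "i < p"
  shows "D i = 0"
proof -
  define S where "S = (\<Sum>i<p. D i)"
  have D: "D i = S" if "i < p" for i
    using assms(2)[OF that] that by (simp add: sum_diff1 S_def)
  have "S = int p * S" using D by (subst S_def) simp
  then have "(int p - 1) * S = 0" by (simp add: algebra_simps)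
  then show ?thesis using assms(1) D[OF assms(3)] by auto
qed

text \<open>This treats one pair of components. Comparing weights of vertices that differ only in
  \<open>t\<close> or only in \<open>s\<close> gives constant column and row sums inside a block.
  Aggregating over parts then equalises the block totals, and the final equation ties their common
  value \<open>B\<close> to \<open>k\<close>.\<close>

lemma constant_part_sums:
  fixes \<phi> :: "nat \<Rightarrow> nat \<Rightarrow> nat \<Rightarrow> nat \<Rightarrow> int"
  assumes pq: "p > 1" "q > 1" and mn: "m > 1" "n \<ge> 4"
    and weight: "\<And>i s j t. i < p \<Longrightarrow> s < m \<Longrightarrow> j < q \<Longrightarrow> t < n \<Longrightarrow>
      (\<Sum>j'\<in>{..<q} - {j}. \<Sum>t'<n. \<phi> i s j' t') + (\<Sum>i'\<in>{..<p} - {i}. \<Sum>s'<m. \<phi> i' s' j t) +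
      (\<Sum>i'\<in>{..<p} - {i}. \<Sum>s'<m. \<Sum>j'\<in>{..<q} - {j}. \<Sum>t'<n. \<phi> i' s' j' t') = k"
  shows "\<exists>B. (\<forall>i<p. \<forall>s<m. \<forall>j<q. int m * (\<Sum>t<n. \<phi> i s j t) = B) \<and>
    (\<forall>i<p. \<forall>j<q. \<forall>t<n. int n * (\<Sum>s<m. \<phi> i s j t) = B) \<and>
    (int n * (int q - 1) + int m * (int p - 1) + int m * int n * (int p - 1) * (int q - 1)) * B = int m * int n * k"
proof -
  define R where "R i s j = (\<Sum>t<n. \<phi> i s j t)" for i s j
  define C where "C i j t = (\<Sum>s<m. \<phi> i s j t)" for i j t
  define B where "B i j = (\<Sum>s<m. R i s j)" for i j
  define r where "r i = (\<Sum>j<q. B i j)" for i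
  define u where "u j = (\<Sum>i<p. B i j)" for j
  define S where "S = (\<Sum>i<p. r i)"
  have BC: "B i j = (\<Sum>t<n. C i j t)" for i j
    unfolding B_def R_def C_def by (rule sum.swap)
  have Su: "S = (\<Sum>j<q. u j)"
    unfolding S_def r_def u_def by (rule sum.swap)
  have third: "(\<Sum>i'\<in>{..<p} - {i}. \<Sum>s'<m. \<Sum>j'\<in>{..<q} - {j}. \<Sum>t'<n. \<phi> i' s' j' t') =
      S - r i - u j + B i j" if ij: "i < p" "j < q" for i j
  proof -
    have "(\<Sum>i'\<in>{..<p} - {i}. \<Sum>s'<m. \<Sum>j'\<in>{..<q} - {j}. \<Sum>t'<n. \<phi> i' s' j' t') =
        (\<Sum>i'\<in>{..<p} - {i}. \<Sum>j'\<in>{..<q} - {j}. B i' j')"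
      unfolding B_def R_def by (rule sum.cong[OF refl], rule sum.swap)
    also have "\<dots> = (\<Sum>i'\<in>{..<p} - {i}. r i' - B i' j)"
      using ij(2) by (intro sum.cong refl) (simp add: r_def sum_diff1)
    also have "\<dots> = S - r i - u j + B i j"
      using ij(1) by (simp add: S_def u_def sum_diff1 sum_subtractf)
    finally show ?thesis .
  qed
  have W: "(\<Sum>j'\<in>{..<q} - {j}. R i s j') + (\<Sum>i'\<in>{..<p} - {i}. C i' j t) + (S - r i - u j + B i j) = k"
    if "i < p" "s < m" "j < q" "t < n" for i s j t
    using weight[OF that] third[OF that(1,3)] unfolding R_def C_def by simp
  have C_const: "C i j t = C i j t'" if "i < p" "j < q" "t < n" "t' < n" for i j t t'
  proof -
    \<comment> \<open>Changing only \<open>t\<close> affects just the second of the three sums in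
      \<open>W\<close>.\<close>
    have "(\<Sum>i'\<in>{..<p} - {i}. C i' j t - C i' j t') = 0" if "i < p" for i
      using W[of i 0 j t] W[of i 0 j t'] that \<open>j < q\<close> \<open>t < n\<close> \<open>t' < n\<close> mn(1)
      by (simp add: sum_subtractf)
    from zero_of_deleted_sums[OF pq(1) this \<open>i < p\<close>] show ?thesis by simp
  qed
  have R_const: "R i s j = R i s' j" if "i < p" "j < q" "s < m" "s' < m" for i s s' j
  proof -
    have "(\<Sum>j'\<in>{..<q} - {j}. R i s j' - R i s' j') = 0" if "j < q" for j
      using W[of i s j 0] W[of i s' j 0] that \<open>i < p\<close> \<open>s < m\<close> \<open>s' < m\<close> mn(2)
      by (simp add: sum_subtractf)
    from zero_of_deleted_sums[OF pq(2) this \<open>j < q\<close>] show ?thesis by simp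
  qed
  have nC: "int n * C i j t = B i j" if "i < p" "j < q" "t < n" for i j t
  proof -
    have "B i j = (\<Sum>t'<n. C i j t)" unfolding BC using that by (intro sum.cong refl C_const) auto
    then show ?thesis by simp
  qed
  have mR: "int m * R i s j = B i j" if "i < p" "j < q" "s < m" for i j s
  proof -
    have "B i j = (\<Sum>s'<m. R i s j)" unfolding B_def using that by (intro sum.cong refl R_const) auto
    then show ?thesis by simp
  qed
  define M where "M = int m"
  define N where "N = int n"
  define P where "P = int p"
  define Q where "Q = int q"
  have E: "N * (r i - B i j) + M * (u j - B i j) + M * N * (S - r i - u j + B i j) = M * N * k"
    if ij: "i < p" "j < q" for i j
  proof -
    have "M * (\<Sum>j'\<in>{..<q} - {j}. R i 0 j') = (\<Sum>j'\<in>{..<q} - {j}. B i j')"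
      unfolding sum_distrib_left M_def using ij mn(1) by (intro sum.cong refl mR) auto
    also have "\<dots> = r i - B i j" using ij(2) by (simp add: r_def sum_diff1)
    finally have 1: "M * (\<Sum>j'\<in>{..<q} - {j}. R i 0 j') = r i - B i j" .
    have "N * (\<Sum>i'\<in>{..<p} - {i}. C i' j 0) = (\<Sum>i'\<in>{..<p} - {i}. B i' j)"
      unfolding sum_distrib_left N_def using ij mn(2) by (intro sum.cong refl nC) auto
    also have "\<dots> = u j - B i j" using ij(1) by (simp add: u_def sum_diff1)
    finally have 2: "N * (\<Sum>i'\<in>{..<p} - {i}. C i' j 0) = u j - B i j" .
    have "M * N * k = N * (M * (\<Sum>j'\<in>{..<q} - {j}. R i 0 j')) + M * (N * (\<Sum>i'\<in>{..<p} - {i}. C i' j 0)) +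
        M * N * (S - r i - u j + B i j)"
      using W[of i 0 j 0] ij mn by (simp add: algebra_simps flip: distrib_left)
    then show ?thesis unfolding 1 2 by simp
  qed
  have MN: "M \<ge> 2" "N \<ge> 4" "P \<ge> 2" "Q \<ge> 2" using pq mn by (auto simp: M_def N_def P_def Q_def)
  \<comment> \<open>Summing \<open>E\<close> over \<open>j\<close> eliminates the single
    \<open>u j\<close> and \<open>B i j\<close>. The coefficient of \<open>r i\<close> is positive,
    so \<open>r i\<close> does not depend on \<open>i\<close>.\<close>
  have ri: "((Q - 1) * (N * (M - 1)) + M) * r i = M * S + M * N * ((Q - 1) * S) - Q * (M * N * k)" if "i < p" for i
  proof -
    have "(\<Sum>j<q. N * (r i - B i j) + M * (u j - B i j) + M * N * (S - r i - u j + B i j)) = (\<Sum>j<q. M * N * k)"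
      using E[OF that] by (intro sum.cong) auto
    then have "N * (Q * r i - r i) + M * (S - r i) + M * N * (Q * (S - r i) - S + r i) = Q * (M * N * k)"
      by (simp add: sum.distrib sum_subtractf Q_def Su r_def flip: sum_distrib_left)
    then show ?thesis by (simp add: algebra_simps)
  qed
  have uj: "((P - 1) * (M * (N - 1)) + N) * u j = N * S + M * N * ((P - 1) * S) - P * (M * N * k)" if "j < q" for j
  proof -
    have "(\<Sum>i<p. N * (r i - B i j) + M * (u j - B i j) + M * N * (S - r i - u j + B i j)) = (\<Sum>i<p. M * N * k)"
      using E[OF _ that] by (intro sum.cong) auto
    then have "N * (S - u j) + M * (P * u j - u j) + M * N * (P * S - S - P * u j + u j) = P * (M * N * k)"
      by (simp add: sum.distrib sum_subtractf P_def S_def u_def flip: sum_distrib_left)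
    then show ?thesis by (simp add: algebra_simps)
  qed
  have r0: "r i = r 0" if "i < p" for i
  proof -
    have "(Q - 1) * (N * (M - 1)) + M > 0" using MN by (intro add_nonneg_pos mult_nonneg_nonneg) auto
    then show ?thesis using ri[OF that] ri[of 0] pq by (metis mult_cancel_left less_irrefl less_trans zero_less_one)
  qed
  have u0: "u j = u 0" if "j < q" for j
  proof -
    have "(P - 1) * (M * (N - 1)) + N > 0" using MN by (intro add_nonneg_pos mult_nonneg_nonneg) auto
    then show ?thesis using uj[OF that] uj[of 0] pq by (metis mult_cancel_left less_irrefl less_trans zero_less_one)
  qed
  have B0: "B i j = B 0 0" if "i < p" "j < q" for i j
  proof -
    \<comment> \<open>Once \<open>r\<close> and \<open>u\<close> are constant, \<open>B i j\<close>
      enters \<open>E\<close> with coefficient MN - M - N = (M - 1)(N - 1) - 1, which the size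
      bounds keep away from zero.\<close>
    have "(M - 1) * (N - 1) \<ge> 1 * 3" using MN by (intro mult_mono) auto
    then have pos: "M * N - M - N \<noteq> 0" by (simp add: algebra_simps)
    have "(M * N - M - N) * B i j = (M * N - M - N) * B 0 0"
      using E[OF that] E[of 0 0] r0[OF that(1)] u0[OF that(2)] pq by (simp add: algebra_simps)
    then show ?thesis using pos by simp
  qed
  have rQ: "r i = Q * B 0 0" if "i < p" for i
  proof -
    have "r i = (\<Sum>j<q. B 0 0)" unfolding r_def using that by (intro sum.cong refl B0) auto
    then show ?thesis by (simp add: Q_def)
  qed
  have "u 0 = (\<Sum>i<p. B 0 0)" unfolding u_def using pq by (intro sum.cong refl B0) auto
  then have uP: "u 0 = P * B 0 0" by (simp add: P_def)
  have "S = (\<Sum>i<p. Q * B 0 0)" unfolding S_def by (intro sum.cong refl rQ) auto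
  then have SPQ: "S = P * (Q * B 0 0)" by (simp add: P_def)
  have r0Q: "r 0 = Q * B 0 0" using rQ pq by simp
  have "N * (r 0 - B 0 0) + M * (u 0 - B 0 0) + M * N * (S - r 0 - u 0 + B 0 0) = M * N * k"
    using E[of 0 0] pq by simp
  then have "(N * (Q - 1) + M * (P - 1) + M * N * (P - 1) * (Q - 1)) * B 0 0 = M * N * k"
    unfolding SPQ r0Q uP by (simp add: algebra_simps)
  moreover have "int m * (\<Sum>t<n. \<phi> i s j t) = B 0 0" if "i < p" "s < m" "j < q" for i s j
    using mR[of i j s] B0[of i j] that unfolding R_def by simp
  moreover have "int n * (\<Sum>s<m. \<phi> i s j t) = B 0 0" if "i < p" "j < q" "t < n" for i j t
    using nC[of i j t] B0[of i j] that unfolding C_def by simp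
  ultimately show ?thesis
    unfolding M_def N_def P_def Q_def by blast
qed

text \<open>All abpq blocks have the same total \<open>B\<close>, so adding all labels 1, ..., N
  gives 2B = mn(N + 1). As \<open>B\<close> is \<open>m\<close> times a row sum and \<open>n\<close>
  times a column sum, both n(N + 1) and m(N + 1) are even.\<close>

lemma distance_magic_imp_parity:
  assumes ab: "a \<ge> 1" "b \<ge> 1" and pq: "p > 1" "q > 1" and mn: "m > 1" "n \<ge> 4"
    and "distance_magic (strong_product (copies a (complete_multipartite m p))
      (copies b (complete_multipartite n q)))"
  shows "even m \<and> even n \<or> odd (m * n * a * b * p * q)"
proof -
  let ?G = "strong_product (copies a (complete_multipartite m p)) (copies b (complete_multipartite n q))"
  define N where "N = a * p * m * (b * q * n)"
  have card: "card (verts ?G) = N"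
    by (simp add: verts_product card_cartesian_product N_def mult.assoc)
  obtain f :: "_ \<Rightarrow> nat" and k where f: "bij_betw f (verts ?G) {1..N}"
    "\<forall>x\<in>verts ?G. (\<Sum>y\<in>nbhd ?G x. f y) = k"
    using assms(7) unfolding distance_magic_def card by blast
  define F where "F y = int (f y)" for y
  define K where "K = int n * (int q - 1) + int m * (int p - 1) + int m * int n * (int p - 1) * (int q - 1)"
  have K: "K > 0"
    unfolding K_def using pq mn by (intro add_pos_nonneg mult_pos_pos mult_nonneg_nonneg) auto
  \<comment> \<open>Solving the equation of \<open>constant_part_sums\<close> for the block total
    makes it visibly independent of the components \<alpha> and \<beta>.\<close>
  define B where "B = int m * int n * int k div K"
  have block: "(\<forall>i<p. \<forall>s<m. \<forall>j<q. int m * (\<Sum>t<n. F ((\<alpha>, i, s), (\<beta>, j, t))) = B) \<and>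
      (\<forall>i<p. \<forall>j<q. \<forall>t<n. int n * (\<Sum>s<m. F ((\<alpha>, i, s), (\<beta>, j, t))) = B)"
    if \<alpha>\<beta>: "\<alpha> < a" "\<beta> < b" for \<alpha> \<beta>
  proof -
    have weight: "(\<Sum>j'\<in>{..<q} - {j}. \<Sum>t'<n. F ((\<alpha>, i, s), (\<beta>, j', t'))) +
        (\<Sum>i'\<in>{..<p} - {i}. \<Sum>s'<m. F ((\<alpha>, i', s'), (\<beta>, j, t))) +
        (\<Sum>i'\<in>{..<p} - {i}. \<Sum>s'<m. \<Sum>j'\<in>{..<q} - {j}. \<Sum>t'<n. F ((\<alpha>, i', s'), (\<beta>, j', t'))) = int k"
      if "i < p" "s < m" "j < q" "t < n" for i s j t
    proof -
      have "((\<alpha>, i, s), (\<beta>, j, t)) \<in> verts ?G" using that \<alpha>\<beta> by (simp add: verts_product)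
      then have "int (\<Sum>y\<in>nbhd ?G ((\<alpha>, i, s), (\<beta>, j, t)). f y) = int k" using f(2) by metis
      then have "(\<Sum>y\<in>nbhd ?G ((\<alpha>, i, s), (\<beta>, j, t)). F y) = int k" unfolding F_def by simp
      then show ?thesis using sum_nbhd_product[of \<alpha> a i p s m \<beta> b j q t n F] that \<alpha>\<beta> by simp
    qed
    obtain B' where B': "\<forall>i<p. \<forall>s<m. \<forall>j<q. int m * (\<Sum>t<n. F ((\<alpha>, i, s), (\<beta>, j, t))) = B'"
      "\<forall>i<p. \<forall>j<q. \<forall>t<n. int n * (\<Sum>s<m. F ((\<alpha>, i, s), (\<beta>, j, t))) = B'"
      "K * B' = int m * int n * int k"
      using constant_part_sums[OF pq mn weight] unfolding K_def by blast
    have "B = B'" unfolding B_def B'(3)[symmetric] using K by simp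
    then show ?thesis using B'(1,2) by blast
  qed
  then have B: "\<And>\<alpha> \<beta> i s j. \<alpha> < a \<Longrightarrow> \<beta> < b \<Longrightarrow> i < p \<Longrightarrow> s < m \<Longrightarrow> j < q \<Longrightarrow>
        int m * (\<Sum>t<n. F ((\<alpha>, i, s), (\<beta>, j, t))) = B" by blast
  have B': "int n * (\<Sum>s<m. F ((0, 0, s), (0, 0, 0))) = B"
    using block[of 0 0] ab pq mn by auto
  have B'': "int m * (\<Sum>t<n. F ((0, 0, 0), (0, 0, t))) = B"
    using B ab pq mn by auto
  have "int m * (\<Sum>y\<in>verts ?G. F y) =
      (\<Sum>\<alpha><a. \<Sum>i<p. \<Sum>s<m. \<Sum>\<beta><b. \<Sum>j<q. int m * (\<Sum>t<n. F ((\<alpha>, i, s), (\<beta>, j, t))))"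
    unfolding verts_product by (simp add: sum_distrib_left sum.cartesian_product')
  also have "\<dots> = (\<Sum>\<alpha><a. \<Sum>i<p. \<Sum>s<m. \<Sum>\<beta><b. \<Sum>j<q. B)"
    using B by (intro sum.cong refl) auto
  also have "\<dots> = int m * (int (a * p * b * q) * B)" by simp
  finally have tot: "(\<Sum>y\<in>verts ?G. F y) = int (a * p * b * q) * B" using mn by simp
  have "(\<Sum>y\<in>verts ?G. F y) = int (\<Sum>y\<in>verts ?G. f y)" by (simp add: F_def)
  also have "(\<Sum>y\<in>verts ?G. f y) = \<Sum>{1..N}" using f(1) by (rule sum.reindex_bij_betw[of f _ _ "\<lambda>x. x"])
  finally have "2 * (int (a * p * b * q) * B) = int (2 * \<Sum>{1..N})" using tot by simp
  also have "2 * \<Sum>{1..N} = N * (N + 1)" by (induction N) auto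
  finally have eq: "2 * (int (a * p * b * q) * B) = int N * int (N + 1)" by (simp add: algebra_simps)
  have Nc: "int N = int (a * p * b * q) * (int m * int n)" by (simp add: N_def)
  have "int (a * p * b * q) * (2 * B) = int (a * p * b * q) * (int m * int n * int (N + 1))"
    using eq unfolding Nc by (simp only: ac_simps)
  moreover have "int (a * p * b * q) \<noteq> 0" using ab pq by simp
  ultimately have B2: "2 * B = int m * int n * int (N + 1)" by (metis mult_cancel_left)
  have "int n * (2 * (\<Sum>s<m. F ((0, 0, s), (0, 0, 0)))) = int n * (int m * int (N + 1))"
    using B2 unfolding B'[symmetric] by (simp only: ac_simps)
  then have "2 * (\<Sum>s<m. F ((0, 0, s), (0, 0, 0))) = int m * int (N + 1)" using mn by simp
  then have m: "even (m * (N + 1))" by (metis dvd_triv_left even_of_nat of_nat_mult)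
  have "int m * (2 * (\<Sum>t<n. F ((0, 0, 0), (0, 0, t)))) = int m * (int n * int (N + 1))"
    using B2 unfolding B''[symmetric] by (simp only: ac_simps)
  then have "2 * (\<Sum>t<n. F ((0, 0, 0), (0, 0, t))) = int n * int (N + 1)" using mn by simp
  then have n: "even (n * (N + 1))" by (metis dvd_triv_left even_of_nat of_nat_mult)
  show ?thesis using m n by (auto simp: N_def)
qed

section \<open>Labellings from magic rectangles\<close>

text \<open>Each pair of partite sets from the two factors receives one rectangle. Its constant row
  and column sums make each of the three sums in \<open>sum_nbhd_product\<close> the same for all
  vertices.\<close>

lemma magic_rectangle_set_imp_distance_magic:
  assumes "magic_rectangle_set m n (a * p * b * q)"
  shows "distance_magic (strong_product (copies a (complete_multipartite m p))
      (copies b (complete_multipartite n q)))"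
proof -
  let ?G = "strong_product (copies a (complete_multipartite m p)) (copies b (complete_multipartite n q))"
  define c where "c = a * p * b * q"
  define N where "N = c * m * n"
  have card: "card (verts ?G) = N"
    by (simp add: verts_product card_cartesian_product N_def c_def)
  have fin: "finite (verts ?G)" by (simp add: verts_product)
  obtain G :: "nat \<Rightarrow> nat \<Rightarrow> nat \<Rightarrow> int" where row: "\<And>k i. k < c \<Longrightarrow> i < m \<Longrightarrow> (\<Sum>j<n. G k i j) = 0"
    and col: "\<And>k j. k < c \<Longrightarrow> j < n \<Longrightarrow> (\<Sum>i<m. G k i j) = 0"
    and surj: "\<And>x. x \<in> {1..N} \<Longrightarrow> \<exists>k<c. \<exists>i<m. \<exists>j<n. G k i j = 2 * int x - int N - 1"
    using assms unfolding magic_rectangle_set_def c_def[symmetric] N_def[symmetric] by blast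
  \<comment> \<open>Mixed radix numbering of the abpq pairs of partite sets.\<close>
  define e where "e \<alpha> i \<beta> j = ((\<alpha> * p + i) * b + \<beta>) * q + j" for \<alpha> i \<beta> j
  have digit: "x * l + y < d * l" if "x < d" "y < l" for x y d l :: nat
  proof -
    have "x * l + y < (x + 1) * l" using that(2) by simp
    also have "\<dots> \<le> d * l" using that(1) by (intro mult_right_mono) auto
    finally show ?thesis .
  qed
  have e: "e \<alpha> i \<beta> j < c" if "\<alpha> < a" "i < p" "\<beta> < b" "j < q" for \<alpha> i \<beta> j
    unfolding e_def c_def by (intro digit that)
  have e_surj: "\<exists>\<alpha><a. \<exists>i<p. \<exists>\<beta><b. \<exists>j<q. e \<alpha> i \<beta> j = k" if "k < c" for k
  proof -
    have 1: "k div q < a * p * b" using that by (simp add: c_def less_mult_imp_div_less)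
    then have 2: "k div q div b < a * p" by (simp add: less_mult_imp_div_less)
    then have 3: "k div q div b div p < a" by (simp add: less_mult_imp_div_less)
    have "q > 0" "b > 0" "p > 0" using that by (auto simp: c_def intro: gr0I)
    moreover have "e (k div q div b div p) (k div q div b mod p) (k div q mod b) (k mod q) = k"
      by (simp add: e_def)
    ultimately show ?thesis using 3 by (meson mod_less_divisor)
  qed
  define g where "g = (\<lambda>((\<alpha>, i, s), (\<beta>, j, t)). G (e \<alpha> i \<beta> j) s t)"
  define f where "f v = nat ((g v + int N + 1) div 2)" for v
  have ex: "\<exists>v\<in>verts ?G. g v = 2 * int x - int N - 1 \<and> f v = x" if x: "x \<in> {1..N}" for x
  proof -
    obtain k s t where kst: "k < c" "s < m" "t < n" "G k s t = 2 * int x - int N - 1"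
      using surj[OF x] by blast
    obtain \<alpha> i \<beta> j where v: "\<alpha> < a" "i < p" "\<beta> < b" "j < q" "e \<alpha> i \<beta> j = k"
      using e_surj[OF kst(1)] by blast
    have "((\<alpha>, i, s), (\<beta>, j, t)) \<in> verts ?G" using v kst by (simp add: verts_product)
    moreover have "g ((\<alpha>, i, s), (\<beta>, j, t)) = 2 * int x - int N - 1" using v(5) kst(4) by (simp add: g_def)
    ultimately show ?thesis by (intro bexI[of _ "((\<alpha>, i, s), (\<beta>, j, t))"]) (simp_all add: f_def)
  qed
  have sub: "{1..N} \<subseteq> f ` verts ?G" using ex by blast
  have "card (f ` verts ?G) \<le> N" using card_image_le[OF fin, of f] card by simp
  then have img: "f ` verts ?G = {1..N}"
    using card_seteq[OF finite_imageI[OF fin] sub] by simp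
  have inj: "inj_on f (verts ?G)" using fin by (rule eq_card_imp_inj_on) (simp add: img card)
  \<comment> \<open>The definition of \<open>f\<close> might truncate or round. That it does not
    follows by counting: \<open>f\<close> is injective, so \<open>v\<close> itself is the vertex
    that \<open>ex\<close> provides for the label \<open>f v\<close>.\<close>
  have fg: "2 * int (f v) = g v + int N + 1" if v: "v \<in> verts ?G" for v
  proof -
    have "f v \<in> {1..N}" using v img by blast
    then obtain v' where "v' \<in> verts ?G" "g v' = 2 * int (f v) - int N - 1" "f v' = f v" using ex by blast
    then have "v' = v" using inj v by (auto dest: inj_onD)
    then show ?thesis using \<open>g v' = 2 * int (f v) - int N - 1\<close> by simp
  qed
  \<comment> \<open>Twice the magic constant: doubled row and column sums are n(N + 1) and m(N + 1),
    which avoids halves.\<close>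
  define w where "w = ((int q - 1) * int n + (int p - 1) * int m + (int p - 1) * int m * ((int q - 1) * int n)) * (int N + 1)"
  have wt: "2 * int (\<Sum>y\<in>nbhd ?G x. f y) = w" if x_in: "x \<in> verts ?G" for x
  proof -
    obtain \<alpha> i s \<beta> j t where x: "x = ((\<alpha>, i, s), (\<beta>, j, t))"
      and lt: "\<alpha> < a" "i < p" "s < m" "\<beta> < b" "j < q" "t < n"
      using x_in by (auto simp: verts_product)
    have "2 * int (\<Sum>y\<in>nbhd ?G x. f y) = (\<Sum>y\<in>nbhd ?G x. 2 * int (f y))" by (simp add: sum_distrib_left)
    also have "\<dots> = (\<Sum>y\<in>nbhd ?G x. g y + int N + 1)"
      by (intro sum.cong refl fg) (simp add: nbhd_def)
    also have "\<dots> = (\<Sum>j'\<in>{..<q} - {j}. \<Sum>t'<n. G (e \<alpha> i \<beta> j') s t' + int N + 1) +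
      (\<Sum>i'\<in>{..<p} - {i}. \<Sum>s'<m. G (e \<alpha> i' \<beta> j) s' t + int N + 1) +
      (\<Sum>i'\<in>{..<p} - {i}. \<Sum>s'<m. \<Sum>j'\<in>{..<q} - {j}. \<Sum>t'<n. G (e \<alpha> i' \<beta> j') s' t' + int N + 1)"
      unfolding x sum_nbhd_product[OF lt, of "\<lambda>y. g y + int N + 1"] by (simp add: g_def)
    also have "\<dots> = (\<Sum>j'\<in>{..<q} - {j}. int n * (int N + 1)) + (\<Sum>i'\<in>{..<p} - {i}. int m * (int N + 1)) +
      (\<Sum>i'\<in>{..<p} - {i}. \<Sum>s'<m. \<Sum>j'\<in>{..<q} - {j}. int n * (int N + 1))"
    proof -
      have "(\<Sum>t'<n. G k s' t' + int N + 1) = int n * (int N + 1)" if "k < c" "s' < m" for k s'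
        using row[OF that] by (simp add: sum.distrib algebra_simps)
      moreover have "(\<Sum>s'<m. G k s' t + int N + 1) = int m * (int N + 1)" if "k < c" for k
        using col[OF that lt(6)] by (simp add: sum.distrib algebra_simps)
      ultimately show ?thesis using lt e by (intro arg_cong2[where f = "(+)"] sum.cong refl) auto
    qed
    also have "\<dots> = w"
      using lt by (simp add: w_def of_nat_diff algebra_simps)
    finally show ?thesis .
  qed
  have "bij_betw f (verts ?G) {1..card (verts ?G)}"
    using inj img card by (simp add: bij_betw_def)
  moreover have "\<forall>x\<in>verts ?G. (\<Sum>y\<in>nbhd ?G x. f y) = nat (w div 2)"
    using wt by (metis nat_int nonzero_mult_div_cancel_left zero_neq_numeral)
  ultimately show ?thesis unfolding distance_magic_def using fin by blast
qed

theorem theorem11: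
  fixes a b m n p q :: nat
  assumes "a \<ge> 1" "b \<ge> 1" "m > 1" "p > 1" "q > 1" "n \<ge> 4"
  shows "distance_magic
           (strong_product (copies a (complete_multipartite m p))
                           (copies b (complete_multipartite n q)))
         \<longleftrightarrow> ((even m \<and> even n) \<or> odd (m * n * a * b * p * q))"
proof
  assume "distance_magic (strong_product (copies a (complete_multipartite m p))
    (copies b (complete_multipartite n q)))"
  then show "(even m \<and> even n) \<or> odd (m * n * a * b * p * q)"
    using distance_magic_imp_parity assms by blast
next
  assume "(even m \<and> even n) \<or> odd (m * n * a * b * p * q)"
  then have "magic_rectangle_set m n (a * p * b * q)"
  proof
    assume "even m \<and> even n"
    then show ?thesis using magic_rectangle_set_even assms(6) by blast
  next
    assume odd: "odd (m * n * a * b * p * q)"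
    then have "odd m" "odd n" "odd (a * p * b * q)" by auto
    moreover from this have "m \<noteq> 2" "n \<noteq> 4" by auto
    then have "m \<ge> 3" "n \<ge> 5" using assms(3,6) by linarith+
    ultimately show ?thesis by (intro magic_rectangle_set_odd)
  qed
  then show "distance_magic (strong_product (copies a (complete_multipartite m p))
    (copies b (complete_multipartite n q)))"
    by (rule magic_rectangle_set_imp_distance_magic)
qed

end
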